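(* If a countable group $G$ admits a central sequence diverging to infinity, then $G$ has the Schmidt property.
   Context: A sequence $(g_n)$ of elements of a countable group $G$ is central if for each $h\in G$, $g_n$ commutes with $h$ for all sufficiently large $n$. It diverges to infinity if it eventually leaves every finite subset of $G$. A p.m.p. action of a countable group $G$ is a measure-preserving (Borel) action of $G$ on a standard probability space $(X,\mu)$; it is free if $\mu$-almost every point has trivial stabilizer. All relations among Borel sets and maps are understood up to null sets. For a p.m.p. action $G\curvearrowright (X,\mu)$, the translation groupoid $\mathcal{G}=G\ltimes (X,\mu)$ is the set $G\times X$ with unit space $X$, range $(g,x)\mapsto gx$, source $(g,x)\mapsto x$, and product $(g,hx)(h,x)=(gh,x)$. Its full group $[\mathcal{G}]$ is the set (modulo null sets) of Borel maps $T\colon X\to G$ such that the map $T^\circ\colon X\to X$, $T^\circ x=(Tx)x$, is an automorphism of $(X,\mu)$, with composition $(S\circ T)x=S(T^\circ x)\,(Tx)$. A sequence $(T_n)$ in $[\mathcal{G}]$ is central if for every $S\in[\mathcal{G}]$, $\mu(\{x\in X\mid (T_n\circ S)x\neq (S\circ T_n)x\})\to 0$. The action (or the groupoid $\mathcal{G}$) is called Schmidt if there is a central sequence $(T_n)$ in $[\mathcal{G}]$ with $\mu(\{x\in X\mid T_n^\circ x\neq x\})\to 1$. The group $G$ has the Schmidt property if it admits a free ergodic p.m.p. action that is Schmidt. *)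

theory Defs
  imports "HOL-Probability.Probability" "HOL-Algebra.Group_Action"
begin

section \<open>Central sequences in groups\<close>

definition central_sequence :: "('g, 'r) monoid_scheme \<Rightarrow> (nat \<Rightarrow> 'g) \<Rightarrow> bool" where
  "central_sequence G g \<longleftrightarrow>
     (\<forall>n. g n \<in> carrier G) \<and>
     (\<forall>h\<in>carrier G. \<forall>\<^sub>F n in sequentially. g n \<otimes>\<^bsub>G\<^esub> h = h \<otimes>\<^bsub>G\<^esub> g n)"

definition diverges_to_infinity :: "('g, 'r) monoid_scheme \<Rightarrow> (nat \<Rightarrow> 'g) \<Rightarrow> bool" where
  "diverges_to_infinity G g \<longleftrightarrow>
     (\<forall>F. finite F \<and> F \<subseteq> carrier G \<longrightarrow> (\<forall>\<^sub>F n in sequentially. g n \<notin> F))"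

section \<open>Probability measure preserving actions\<close>

text \<open>The topology is any Polish topology on the underlying set; it is unrelated to a
  topology that the type \<open>'x\<close> may carry.\<close>

definition standard_borel :: "'x measure \<Rightarrow> bool" where
  "standard_borel M \<longleftrightarrow>
     (\<exists>T. topspace T = space M \<and> completely_metrizable_space T \<and> second_countable T \<and>
          sets M = sigma_sets (space M) {U. openin T U})"

definition standard_prob_space :: "'x measure \<Rightarrow> bool" where
  "standard_prob_space M \<longleftrightarrow> standard_borel M \<and> prob_space M"

definition measure_preserving_map :: "'x measure \<Rightarrow> ('x \<Rightarrow> 'x) \<Rightarrow> bool" where
  "measure_preserving_map M f \<longleftrightarrow> f \<in> measurable M M \<and> distr M M f = M"

text \<open>Automorphisms are taken modulo null sets: a measure preserving Borel map with a measure
  preserving Borel inverse almost everywhere.\<close>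

definition automorphism_mod_null :: "'x measure \<Rightarrow> ('x \<Rightarrow> 'x) \<Rightarrow> bool" where
  "automorphism_mod_null M f \<longleftrightarrow>
     measure_preserving_map M f \<and>
     (\<exists>f'. measure_preserving_map M f' \<and> (AE x in M. f' (f x) = x) \<and> (AE x in M. f (f' x) = x))"

definition pmp_action :: "('g, 'r) monoid_scheme \<Rightarrow> 'x measure \<Rightarrow> ('g \<Rightarrow> 'x \<Rightarrow> 'x) \<Rightarrow> bool" where
  "pmp_action G M \<phi> \<longleftrightarrow>
     standard_prob_space M \<and> group_action G (space M) \<phi> \<and>
     (\<forall>g\<in>carrier G. measure_preserving_map M (\<phi> g))"

definition free_action :: "('g, 'r) monoid_scheme \<Rightarrow> 'x measure \<Rightarrow> ('g \<Rightarrow> 'x \<Rightarrow> 'x) \<Rightarrow> bool" where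
  "free_action G M \<phi> \<longleftrightarrow> (AE x in M. stabilizer G \<phi> x = {\<one>\<^bsub>G\<^esub>})"

text \<open>Invariance of a set is understood up to null sets.\<close>

definition ergodic_action :: "('g, 'r) monoid_scheme \<Rightarrow> 'x measure \<Rightarrow> ('g \<Rightarrow> 'x \<Rightarrow> 'x) \<Rightarrow> bool" where
  "ergodic_action G M \<phi> \<longleftrightarrow>
     (\<forall>A\<in>sets M. (\<forall>g\<in>carrier G. AE x in M. \<phi> g x \<in> A \<longleftrightarrow> x \<in> A) \<longrightarrow>
        measure M A = 0 \<or> measure M A = 1)"

section \<open>The full group of the translation groupoid\<close>

text \<open>\<open>T : X \<rightarrow> G\<close> stands for the section \<open>x \<mapsto> (T x, x)\<close> of the source map of
  \<open>G \<ltimes> X\<close>; \<open>induced_map \<phi> T\<close> is \<open>T\<^sup>\<circ>\<close>.\<close>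

definition induced_map :: "('g \<Rightarrow> 'x \<Rightarrow> 'x) \<Rightarrow> ('x \<Rightarrow> 'g) \<Rightarrow> 'x \<Rightarrow> 'x" where
  "induced_map \<phi> T x = \<phi> (T x) x"

text \<open>Elements of the full group are represented by Borel maps, without passing to the quotient
  by almost everywhere equality; all notions below are invariant under it.\<close>

definition full_group ::
    "('g, 'r) monoid_scheme \<Rightarrow> 'x measure \<Rightarrow> ('g \<Rightarrow> 'x \<Rightarrow> 'x) \<Rightarrow> ('x \<Rightarrow> 'g) set" where
  "full_group G M \<phi> =
     {T \<in> measurable M (count_space (carrier G)). automorphism_mod_null M (induced_map \<phi> T)}"

definition full_group_comp ::
    "('g, 'r) monoid_scheme \<Rightarrow> ('g \<Rightarrow> 'x \<Rightarrow> 'x) \<Rightarrow> ('x \<Rightarrow> 'g) \<Rightarrow> ('x \<Rightarrow> 'g) \<Rightarrow> 'x \<Rightarrow> 'g" where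
  "full_group_comp G \<phi> S T x = S (induced_map \<phi> T x) \<otimes>\<^bsub>G\<^esub> T x"

definition full_group_central_sequence ::
    "('g, 'r) monoid_scheme \<Rightarrow> 'x measure \<Rightarrow> ('g \<Rightarrow> 'x \<Rightarrow> 'x) \<Rightarrow> (nat \<Rightarrow> 'x \<Rightarrow> 'g) \<Rightarrow> bool" where
  "full_group_central_sequence G M \<phi> T \<longleftrightarrow>
     (\<forall>n. T n \<in> full_group G M \<phi>) \<and>
     (\<forall>S\<in>full_group G M \<phi>.
        (\<lambda>n. measure M {x \<in> space M. full_group_comp G \<phi> (T n) S x \<noteq> full_group_comp G \<phi> S (T n) x})
          \<longlonglongrightarrow> 0)"

definition schmidt_action :: "('g, 'r) monoid_scheme \<Rightarrow> 'x measure \<Rightarrow> ('g \<Rightarrow> 'x \<Rightarrow> 'x) \<Rightarrow> bool" where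
  "schmidt_action G M \<phi> \<longleftrightarrow>
     (\<exists>T. full_group_central_sequence G M \<phi> T \<and>
          (\<lambda>n. measure M {x \<in> space M. induced_map \<phi> (T n) x \<noteq> x}) \<longlonglongrightarrow> 1)"

text \<open>HOL cannot quantify over the type of the points of the space. Having points of type
  \<^typ>\<open>real\<close> is no restriction: a standard Borel space has at most continuum many points, so it
  can be transported along an injection into the reals, and \<^const>\<open>standard_borel\<close> allows any
  underlying set and any Polish topology on it.\<close>

definition schmidt_property :: "('g, 'r) monoid_scheme \<Rightarrow> bool" where
  "schmidt_property G \<longleftrightarrow>
     (\<exists>(M :: real measure) \<phi>.
        pmp_action G M \<phi> \<and> free_action G M \<phi> \<and> ergodic_action G M \<phi> \<and> schmidt_action G M \<phi>)"

end

theory Submission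
  imports Defs "HOL-Algebra.FiniteProduct"
begin

text \<open>
  Let \<open>g\<close> be a central sequence in \<open>G\<close> that diverges to infinity. The constant functions
  \<open>T\<^sub>n = a\<^sub>n\<close> of a central sequence \<open>a\<close> in \<open>G\<close> commute asymptotically with an element \<open>S\<close> of the
  full group as soon as \<open>S (a\<^sub>n x) = S x\<close> holds on a set whose measure tends to \<open>1\<close>: on the rest
  of the space \<open>a\<^sub>n\<close> eventually commutes with the value \<open>S x\<close>. So it suffices to find a free ergodic
  p.m.p. action of \<open>G\<close> and a central sequence of nontrivial elements that converges to the identity
  pointwise (\<open>schmidt_propertyI\<close>).

  Since every \<open>g\<^sub>m\<close> commutes with almost all \<open>g\<^sub>n\<close>, a subsequence consists of distinct, pairwise
  commuting elements, and these lie in an abelian subgroup \<open>A\<close>. Choose countably many characters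
  \<open>\<theta>\<^sub>j\<close> of \<open>A\<close> that separate its points. By compactness of the torus, all \<open>\<theta>\<^sub>j (g\<^sub>n)\<close> converge along
  a further subsequence; the quotients \<open>a\<^sub>n\<close> of its consecutive terms are nontrivial, still form a
  central sequence, and satisfy \<open>\<theta>\<^sub>j (a\<^sub>n) \<longlonglongrightarrow> 1\<close> for all \<open>j\<close> (\<open>central_sequence_with_characters\<close>).
  Hence \<open>A\<close> acts freely on the infinite torus by the rotations \<open>(\<theta>\<^sub>j (x))\<^sub>j\<close>, and \<open>a\<^sub>n\<close> tends to the
  identity there. It remains to pass from \<open>A\<close> to \<open>G\<close>, by means of coset representatives \<open>s\<^sub>p\<close> of
  \<open>G / A\<close> and the cocycle with values in \<open>A\<close> that they define. Whatever \<open>p\<close> is, \<open>a\<^sub>n\<close> commutes with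
  \<open>s\<^sub>p\<close> for large \<open>n\<close>, so that it fixes \<open>p\<close> and has cocycle value \<open>a\<^sub>n\<close> there; thus convergence to the
  identity survives both constructions below.

  \<^item> If \<open>A\<close> has infinite index, \<open>G\<close> acts on the torus with coordinates \<open>G / A \<times> \<nat>\<close> by co-induction.
    The Fourier coefficients of an invariant set have constant modulus along the orbits of \<open>G\<close> on
    the nontrivial characters of this torus. These orbits are infinite because \<open>G / A\<close> is, so the
    coefficients vanish by Bessel's inequality and the action is ergodic
    (\<open>schmidt_property_infinite_index\<close>).

  \<^item> If \<open>A\<close> has finite index, the co-induced action need not be ergodic, and \<open>G\<close> acts instead on
    \<open>G / A \<times> K\<close> by induction, where \<open>K\<close> is the closure of the image of \<open>A\<close> in the torus with its Haar
    measure. Ergodicity now follows from the density of \<open>A\<close> in \<open>K\<close>: every character of the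
    torus that is nontrivial on \<open>K\<close> is nontrivial on \<open>A\<close> (\<open>schmidt_property_finite_index\<close>).

  Haar measures of closed subgroups of the torus enter three times, and always in the form of
  \<open>haar_law_exists\<close>: for every group \<open>R\<close> of finitely supported integer vectors there is a measure on
  the torus whose Fourier coefficient at \<open>n\<close> is \<open>1\<close> for \<open>n \<in> R\<close> and \<open>0\<close> otherwise. With \<open>R = 0\<close> it is
  the measure of the first case, and with the relations that hold between the \<open>\<theta>\<^sub>j\<close> it is the
  measure on \<open>K\<close>. With the relations between the elements of \<open>A\<close> it is the Haar measure of the dual
  group of \<open>A\<close>, so that a random point is a character; this is where the \<open>\<theta>\<^sub>j\<close> come from. Since a
  measure on the torus is determined by its Fourier coefficients (\<open>measure_eqI_monomial\<close>), invariance
  and ergodicity become statements about coefficients.\<close>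

section \<open>Haar measures on closed subgroups of the infinite torus\<close>

text \<open>The mean of points in the unit disc is the extreme point \<open>1\<close> only if almost all of them are \<open>1\<close>.\<close>

lemma (in prob_space) AE_eq_1_if_expectation_eq_1:
  fixes f :: "'a \<Rightarrow> complex"
  assumes [measurable]: "f \<in> borel_measurable M" and le: "\<And>x. norm (f x) \<le> 1"
    and eq: "expectation f = 1"
  shows "AE x in M. f x = 1"
proof -
  have int: "integrable M f"
    by (rule integrable_const_bound[where B=1]) (use le in auto)
  have "expectation (\<lambda>x. Re (f x)) = 1"
    using eq int by simp
  moreover have "integrable M (\<lambda>x. Re (f x))" using int by simp
  ultimately have "expectation (\<lambda>x. 1 - Re (f x)) = 0"
    by (simp add: prob_space)
  moreover have nn: "0 \<le> 1 - Re (f x)" for x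
    using le[of x] complex_Re_le_cmod[of "f x"] by linarith
  moreover have "integrable M (\<lambda>x. 1 - Re (f x))" using int by auto
  ultimately have "AE x in M. 1 - Re (f x) = 0"
    by (subst (asm) integral_nonneg_eq_0_iff_AE) auto
  then show ?thesis
  proof eventually_elim
    case (elim x)
    then have "Re (f x) = 1" by simp
    moreover have "(Re (f x))\<^sup>2 + (Im (f x))\<^sup>2 \<le> 1"
      using le[of x] by (simp add: cmod_def)
    ultimately show ?case by (simp add: complex_eq_iff)
  qed
qed

lemma borel_measurable_cis [measurable]: "cis \<in> borel_measurable borel"
  by (intro borel_measurable_continuous_onI continuous_intros)

text \<open>Together with the next lemma this provides, for every \<open>k \<ge> 0\<close>, a random angle whose \<open>l\<close>-th
  moment on the circle is the indicator of \<open>k dvd l\<close>; the case \<open>k = 0\<close> is the uniform angle.\<close>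

lemma exists_uniform_circle_angle:
  "\<exists>W :: real measure. prob_space W \<and> sets W = sets borel \<and>
     (\<forall>l :: int. (\<integral>w. cis (2 * pi * (real_of_int l * w)) \<partial>W) = (if l = (0::int) then 1 else 0))"
proof (intro exI conjI allI)
  let ?U = "density lborel (\<lambda>x. ennreal (indicator {0..1::real} x))"
  show P: "prob_space ?U"
    by (rule prob_spaceI) (simp add: emeasure_density ennreal_indicator)
  then interpret prob_space ?U .
  show "sets ?U = sets borel" by simp
  fix l :: int
  show "(\<integral>w. cis (2 * pi * (l * w)) \<partial>?U) = (if l = 0 then 1 else 0)"
  proof (cases "l = 0")
    case True then show ?thesis using prob_space by simp
  next
    case False
    define c where "c = 2 * pi * l * \<i>"
    have c: "c \<noteq> 0" using False by (simp add: c_def)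
    have cis_exp: "cis (2 * pi * (l * x)) = exp (c * of_real x)" for x :: real
      by (simp add: cis_conv_exp c_def algebra_simps)
    define F where "F = (\<lambda>x::real. exp (c * of_real x) / c)"
    have "has_bochner_integral lborel (\<lambda>x. indicator {0..1} x *\<^sub>R exp (c * of_real x)) (F 1 - F 0)"
    proof (rule has_bochner_integral_FTC_Icc)
      fix x :: real
      have "((\<lambda>z. exp (c * z) / c) has_field_derivative exp (c * of_real x)) (at (of_real x))"
        by (rule derivative_eq_intros refl)+ (use c in \<open>auto simp: field_simps\<close>)
      then show "(F has_vector_derivative exp (c * of_real x)) (at x within {0..1})"
        unfolding F_def by (rule has_vector_derivative_real_field)
      show "continuous_on {0..1} (\<lambda>x::real. exp (c * of_real x))"
        by (intro continuous_intros)
    qed simp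
    moreover have "F 1 - F 0 = 0"
      using cis_exp[of 1] by (simp add: F_def cis_multiple_2pi)
    ultimately have "(\<integral>x. indicator {0..1} x *\<^sub>R cis (2 * pi * (l * x)) \<partial>lborel) = 0"
      by (simp add: has_bochner_integral_integral_eq cis_exp)
    then show ?thesis
      using False by (subst integral_density) auto
  qed
qed

lemma exists_uniform_root_of_unity_angle:
  assumes "k > 0"
  shows "\<exists>W :: real measure. prob_space W \<and> sets W = sets borel \<and>
     (\<forall>l :: int. (\<integral>w. cis (2 * pi * (l * w)) \<partial>W) = (if int k dvd l then 1 else 0))"
proof (intro exI conjI allI)
  define p where "p = map_pmf (\<lambda>j::nat. real j / real k) (pmf_of_set {..<k})"
  let ?W = "distr (measure_pmf p) borel (\<lambda>x. x)"
  show P: "prob_space ?W" by (rule measure_pmf.prob_space_distr) auto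
  show "sets ?W = sets borel" by simp
  fix l :: int
  define z where "z = cis (2 * pi * l / k)"
  have "(\<integral>w. cis (2 * pi * (l * w)) \<partial>?W) = (\<integral>w. cis (2 * pi * (l * w)) \<partial>measure_pmf p)"
    by (rule integral_distr) (simp, rule borel_measurable_continuous_onI, intro continuous_intros)
  also have "\<dots> = (\<integral>j. cis (2 * pi * (l * (real j / real k))) \<partial>measure_pmf (pmf_of_set {..<k}))"
    by (simp add: p_def)
  also have "\<dots> = (\<Sum>j<k. cis (2 * pi * (l * (real j / real k)))) / k"
    using assms by (subst integral_measure_pmf[of "{..<k}"])
      (auto simp: lessThan_empty_iff set_pmf_of_set pmf_of_set scaleR_conv_of_real sum_divide_distrib
        intro!: sum.cong)
  also have "(\<Sum>j<k. cis (2 * pi * (l * (real j / real k)))) = (\<Sum>j<k. z ^ j)"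
  proof (rule sum.cong)
    fix j
    have "2 * pi * (l * (real j / real k)) = real j * (2 * pi * l / k)" by simp
    moreover have "z ^ j = cis (real j * (2 * pi * l / k))" unfolding z_def by (rule Complex.DeMoivre)
    ultimately show "cis (2 * pi * (l * (real j / real k))) = z ^ j" by (simp only:)
  qed simp
  also have "\<dots> / k = (if int k dvd l then 1 else 0)"
  proof (cases "int k dvd l")
    case True
    then obtain q where "l = int k * q" by blast
    then have "2 * pi * l / k = 2 * pi * q" using assms by simp
    then have "z = 1" by (simp only: z_def cis_multiple_2pi Ints_of_int)
    then show ?thesis using True assms by simp
  next
    case False
    have "z \<noteq> 1"
    proof
      assume "z = 1"
      then have "cos (2 * pi * l / k) = 1" unfolding z_def by (metis cis.sel(1) one_complex.sel(1))
      then obtain q :: int where "2 * pi * l / k = of_int q * 2 * pi"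
        unfolding cos_one_2pi_int by blast
      then have "real_of_int l = real_of_int (q * int k)" using assms by (simp add: field_simps)
      then have "l = q * int k" by (simp only: of_int_eq_iff)
      then show False using False by simp
    qed
    moreover have "z ^ k = 1"
    proof -
      have "z ^ k = cis (real k * (2 * pi * l / k))" unfolding z_def by (rule Complex.DeMoivre)
      also have "real k * (2 * pi * l / k) = 2 * pi * l" using assms by simp
      finally show ?thesis by (simp only: cis_multiple_2pi Ints_of_int)
    qed
    ultimately have "(\<Sum>j<k. z ^ j) = 0"
      by (simp add: geometric_sum)
    then show ?thesis using False by simp
  qed
  finally show "(\<integral>w. cis (2 * pi * (l * w)) \<partial>?W) = (if int k dvd l then 1 else 0)" .
qed

text \<open>These are the subgroups of the dual group of the infinite torus.\<close>

definition relation_group :: "(nat \<Rightarrow> int) set \<Rightarrow> bool" where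
  "relation_group R \<longleftrightarrow> (\<lambda>_. 0) \<in> R \<and> (\<forall>n\<in>R. finite {i. n i \<noteq> 0}) \<and>
     (\<forall>n\<in>R. \<forall>m\<in>R. (\<lambda>i. n i - m i) \<in> R)"

text \<open>On the torus these are the characters.\<close>

definition monomial :: "(nat \<Rightarrow> int) \<Rightarrow> (nat \<Rightarrow> complex) \<Rightarrow> complex" where
  "monomial n x = (\<Prod>i | n i \<noteq> 0. x i powi n i)"

definition torus :: "(nat \<Rightarrow> complex) set" where
  "torus = {x. \<forall>i. norm (x i) = 1}"

text \<open>The Haar measure of the closed subgroup of all \<open>x\<close> in the torus with \<open>monomial n x = 1\<close> for
  \<open>n \<in> R\<close>, characterised by its Fourier coefficients.\<close>

definition haar_law :: "(nat \<Rightarrow> int) set \<Rightarrow> (nat \<Rightarrow> complex) measure \<Rightarrow> bool" where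
  "haar_law R \<mu> \<longleftrightarrow> prob_space \<mu> \<and> sets \<mu> = sets borel \<and> (AE x in \<mu>. x \<in> torus) \<and>
     (\<forall>n. finite {i. n i \<noteq> 0} \<longrightarrow> (\<integral>x. monomial n x \<partial>\<mu>) = (if n \<in> R then 1 else 0))"

lemma monomial_eq_prod:
  "finite F \<Longrightarrow> {i. n i \<noteq> 0} \<subseteq> F \<Longrightarrow> monomial n x = (\<Prod>i\<in>F. x i powi n i)"
  unfolding monomial_def by (rule prod.mono_neutral_left) auto

lemma relation_group_diff:
  "relation_group R \<Longrightarrow> n \<in> R \<Longrightarrow> m \<in> R \<Longrightarrow> (\<lambda>i. n i - m i) \<in> R"
  by (auto simp: relation_group_def)

lemma relation_group_add:
  assumes "relation_group R" "n \<in> R" "m \<in> R"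
  shows "(\<lambda>i. n i + m i) \<in> R"
proof -
  have "(\<lambda>i. 0 - m i) \<in> R"
    using assms relation_group_diff[of R "\<lambda>_. 0" m] by (auto simp: relation_group_def)
  from relation_group_diff[OF assms(1,2) this] show ?thesis by simp
qed

lemma relation_group_scale:
  assumes R: "relation_group R" and n: "n \<in> R"
  shows "(\<lambda>i. q * n i) \<in> R"
proof (induction q rule: int_induct[where k = 0])
  case base then show ?case using R by (simp add: relation_group_def)
next
  case (step1 q)
  then show ?case using relation_group_add[OF R step1(2) n] by (simp add: algebra_simps)
next
  case (step2 q)
  then show ?case using relation_group_diff[OF R step2(2) n] by (simp add: algebra_simps)
qed

text \<open>The \<open>N\<close>-th entries of the vectors in \<open>R\<close> that are supported in \<open>{..N}\<close> form an ideal of the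
  integers, here with generator \<open>k\<close>. For the zero ideal, \<open>k = 0\<close> and \<open>r = 0\<close>, which spares
  a case distinction in what follows.\<close>

lemma relation_group_leading_coefficient:
  assumes R: "relation_group R"
  obtains k r where "r \<in> R" "\<And>i. N < i \<Longrightarrow> r i = 0" "r N = int k"
    "\<And>n. n \<in> R \<Longrightarrow> (\<And>i. N < i \<Longrightarrow> n i = 0) \<Longrightarrow> int k dvd n N"
proof -
  define Q where "Q k r \<longleftrightarrow> r \<in> R \<and> (\<forall>i>N. r i = 0) \<and> r N = int k" for k r
  show thesis
  proof (cases "\<exists>k>0. \<exists>r. Q k r")
    case False
    have "n N = 0" if n: "n \<in> R" "\<And>i. N < i \<Longrightarrow> n i = 0" for n
    proof (rule ccontr)
      assume "n N \<noteq> 0"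
      moreover have "Q (nat (n N)) n" if "n N > 0" using that n by (simp add: Q_def)
      moreover have "Q (nat (- n N)) (\<lambda>i. -1 * n i)" if "n N < 0"
        using that n relation_group_scale[OF R n(1), of "- 1"] unfolding Q_def by auto
      ultimately show False using False
        by (metis linorder_neqE_linordered_idom neg_0_less_iff_less zero_less_nat_eq)
    qed
    then show thesis
      using R by (intro that[of "\<lambda>_. 0" 0]) (auto simp: relation_group_def)
  next
    case True
    define k where "k = (LEAST k. k > 0 \<and> (\<exists>r. Q k r))"
    have "k > 0 \<and> (\<exists>r. Q k r)" unfolding k_def by (rule LeastI_ex) (use True in auto)
    then obtain r where k: "k > 0" and r: "r \<in> R" "\<forall>i>N. r i = 0" "r N = int k"
      by (auto simp: Q_def)
    have "int k dvd n N" if n: "n \<in> R" "\<And>i. N < i \<Longrightarrow> n i = 0" for n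
    proof (rule ccontr)
      assume nd: "\<not> int k dvd n N"
      define m where "m = (\<lambda>i. n i - (n N div int k) * r i)"
      have "m \<in> R" unfolding m_def by (intro relation_group_diff relation_group_scale R n r)
      moreover have mN: "m N = n N mod int k"
        by (simp add: m_def r minus_div_mult_eq_mod)
      moreover have "m N > 0"
        using nd k mN by (metis dvd_eq_mod_eq_0 of_nat_0_less_iff order_le_less pos_mod_sign)
      moreover have "\<forall>i>N. m i = 0" using n r by (simp add: m_def)
      ultimately have "Q (nat (m N)) m" "nat (m N) > 0" by (auto simp: Q_def)
      then have "k \<le> nat (m N)" unfolding k_def by (intro Least_le) auto
      then show False using mN k pos_mod_bound[of "int k" "n N"] by linarith
    qed
    then show thesis using r by (intro that[of r k]) auto
  qed
qed

text \<open>The coordinates of the random point, as real numbers modulo \<open>1\<close>. The relation with leading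
  coefficient \<open>k N\<close> leaves \<open>k N\<close> choices for the \<open>N\<close>-th coordinate once the earlier ones are known;
  \<open>w N\<close> selects one of them. For \<open>k N = 0\<close> there is no constraint, and the division by zero makes
  the correction term vanish as it should.\<close>

fun angle :: "(nat \<Rightarrow> nat) \<Rightarrow> (nat \<Rightarrow> nat \<Rightarrow> int) \<Rightarrow> (nat \<Rightarrow> real) \<Rightarrow> nat \<Rightarrow> real" where
  "angle k r w N = w N - (\<Sum>i<N. r N i * angle k r w i) / k N"

declare angle.simps [simp del]

lemma angle_cong:
  "(\<And>i. i \<le> N \<Longrightarrow> w i = w' i) \<Longrightarrow> angle k r w N = angle k r w' N"
proof (induction N rule: less_induct)
  case (less N)
  have "(\<Sum>i<N. r N i * angle k r w i) = (\<Sum>i<N. r N i * angle k r w' i)"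
    by (rule sum.cong) (use less in auto)
  then show ?case using less.prems[of N] by (simp add: angle.simps[of _ _ _ N])
qed

lemma measurable_angle:
  "{..N} \<subseteq> I \<Longrightarrow> (\<lambda>w. angle k r w N) \<in> borel_measurable (PiM I (\<lambda>_. borel))"
proof (induction N rule: less_induct)
  case (less N)
  have [measurable]: "(\<lambda>w. angle k r w i) \<in> borel_measurable (PiM I (\<lambda>_. borel))" if "i < N" for i
    using that less by force
  have "(\<lambda>w. w N - (\<Sum>i<N. r N i * angle k r w i) / k N) \<in> borel_measurable (PiM I (\<lambda>_. borel))"
    using less.prems by (intro borel_measurable_diff borel_measurable_divide borel_measurable_sum
      borel_measurable_times) auto
  then show ?case by (simp add: angle.simps[of _ _ _ N])
qed

lemma cis_sum: "cis (\<Sum>i\<in>A. f i) = (\<Prod>i\<in>A. cis (f i))"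
  by (induction A rule: infinite_finite_induct) (simp_all add: cis_mult[symmetric])

lemma borel_measurable_coordinate [measurable]: "(\<lambda>x :: nat \<Rightarrow> complex. x i) \<in> borel_measurable borel"
  by (intro borel_measurable_continuous_onI continuous_on_product_coordinates)

lemma measurable_monomial [measurable]: "monomial n \<in> borel_measurable borel"
proof -
  have "(\<lambda>x :: nat \<Rightarrow> complex. x i powi k) \<in> borel_measurable borel" for i k
    by (cases "k \<ge> 0") (simp_all add: power_int_def)
  then show ?thesis unfolding monomial_def[abs_def] by (intro borel_measurable_prod)
qed

lemma compact_torus: "compact torus"
proof -
  have "compactin (product_topology (\<lambda>_. euclidean) UNIV) (PiE UNIV (\<lambda>_::nat. sphere (0::complex) 1))"
    unfolding compactin_PiE by (auto simp: compactin_euclidean_iff)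
  moreover have "PiE UNIV (\<lambda>_::nat. sphere (0::complex) 1) = torus"
    by (auto simp: torus_def PiE_def)
  ultimately show ?thesis by (simp add: euclidean_product_topology compactin_euclidean_iff)
qed

lemma torus_in_borel [measurable]: "torus \<in> sets borel"
  by (intro borel_closed compact_imp_closed compact_torus)

text \<open>The coordinates of a random point of the subgroup are chosen one after the other, each uniformly
  among the values that the relations still permit. A coefficient is then computed by integrating
  out the last coordinate: this gives \<open>0\<close> unless the generator \<open>k\<close> of the leading coefficients divides
  the last entry of \<open>n\<close>, and in that case subtracting a multiple of the relation that realises
  \<open>k\<close> removes the last entry without affecting membership in \<open>R\<close>.\<close>

lemma haar_law_exists:
  assumes R: "relation_group R"
  shows "\<exists>\<mu>. haar_law R \<mu>"
proof -
  have "\<forall>N. \<exists>k r. r \<in> R \<and> (\<forall>i>N. r i = 0) \<and> r N = int k \<and>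
      (\<forall>n\<in>R. (\<forall>i>N. n i = 0) \<longrightarrow> int k dvd n N)"
    by (metis relation_group_leading_coefficient[OF R])
  then obtain k :: "nat \<Rightarrow> nat" and r where r: "r N \<in> R" "\<And>i. N < i \<Longrightarrow> r N i = 0" "r N N = int (k N)"
      and dvd: "\<And>n. n \<in> R \<Longrightarrow> (\<And>i. N < i \<Longrightarrow> n i = 0) \<Longrightarrow> int (k N) dvd n N" for N
    by metis
  have "\<exists>W :: real measure. prob_space W \<and> sets W = sets borel \<and>
     (\<forall>l :: int. (\<integral>w. cis (2 * pi * (real_of_int l * w)) \<partial>W) = (if int (k N) dvd l then 1 else 0))" for N
  proof (cases "k N = 0")
    case True then show ?thesis using exists_uniform_circle_angle by simp
  next
    case False then show ?thesis using exists_uniform_root_of_unity_angle[of "k N"] by simp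
  qed
  then obtain W :: "nat \<Rightarrow> real measure" where W: "prob_space (W N)" "sets (W N) = sets borel"
     "(\<integral>w. cis (2 * pi * (real_of_int l * w)) \<partial>W N) = (if int (k N) dvd l then 1 else 0)" for N and l :: int
    by metis
  interpret P: product_prob_space W UNIV
    by (intro product_prob_spaceI W)
  define \<Omega> where "\<Omega> = PiM UNIV W"
  have sets_\<Omega>: "sets \<Omega> = sets (PiM UNIV (\<lambda>_. borel))"
    unfolding \<Omega>_def by (intro sets_PiM_cong W refl)
  interpret \<Omega>: prob_space \<Omega>
    unfolding \<Omega>_def by (rule P.prob_space_axioms)
  have meas_\<Omega>: "measurable \<Omega> N = measurable (PiM UNIV (\<lambda>_. borel)) N" for N :: "'z measure"
    by (rule measurable_cong_sets) (use sets_\<Omega> in auto)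
  define t where "t = angle k r"
  have t: "t w N = w N - (\<Sum>i<N. r N i * t w i) / k N" for w N
    unfolding t_def by (rule angle.simps)
  have [measurable]: "(\<lambda>w. t w N) \<in> borel_measurable \<Omega>" for N
    unfolding meas_\<Omega> t_def by (rule measurable_angle) simp
  have indep: "\<Omega>.indep_vars W (\<lambda>i w. w i) UNIV"
  proof (subst \<Omega>.indep_vars_iff_distr_eq_PiM)
    show "distr \<Omega> (PiM UNIV W) (\<lambda>x. \<lambda>i\<in>UNIV. x i) = PiM UNIV (\<lambda>i. distr \<Omega> (W i) (\<lambda>w. w i))"
      unfolding \<Omega>_def by (simp add: P.PiM_component restrict_def)
  qed (simp_all add: \<Omega>_def)
  have main: "(\<integral>w. cis (2 * pi * (\<Sum>i<N. n i * t w i)) \<partial>\<Omega>) = (if n \<in> R then 1 else 0)"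
    if "\<And>i. N \<le> i \<Longrightarrow> n i = 0" for N and n :: "nat \<Rightarrow> int"
    using that
  proof (induction N arbitrary: n)
    case 0
    then have "n = (\<lambda>_. 0)" by auto
    then have "n \<in> R" using R by (simp add: relation_group_def)
    then show ?case using \<Omega>.prob_space by simp
  next
    case (Suc N)
    \<comment> \<open>\<open>n'\<close> is \<open>n\<close> with its last entry cleared, if \<open>k N\<close> divides it. For \<open>k N = 0\<close> the quotient
      \<open>q\<close> is \<open>0\<close>.\<close>
    define q where "q = n N div int (k N)"
    define n' where "n' = (\<lambda>i. n i - q * r N i)"
    have n'_iff: "n' \<in> R \<longleftrightarrow> n \<in> R"
    proof
      assume "n' \<in> R"
      from relation_group_add[OF R this relation_group_scale[OF R r(1)[of N], of q]]
      show "n \<in> R" by (simp add: n'_def)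
    next
      assume "n \<in> R"
      then show "n' \<in> R"
        unfolding n'_def by (intro relation_group_diff relation_group_scale R r)
    qed
    define s where "s = (\<lambda>v. \<Sum>i<N. n i * t v i)"
    define u where "u = (\<lambda>v. (\<Sum>i<N. r N i * t v i) / k N)"
    have top_split: "(\<Sum>i<Suc N. n i * t w i) = n N * w N + (s w - n N * u w)" for w :: "nat \<Rightarrow> real"
      by (simp add: t[of w N] s_def u_def algebra_simps)
    have local: "t (restrict w {..<N}) i = t w i" if "i < N" for w i
      unfolding t_def by (rule angle_cong) (use that in auto)
    let ?X1 = "\<lambda>w::nat\<Rightarrow>real. cis (2 * pi * (n N * w N))" and ?X2 = "\<lambda>w. cis (2 * pi * (s w - n N * u w))"
    have meas_t: "(\<lambda>w. t w i) \<in> borel_measurable (PiM {..<N} W)" if "i < N" for i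
    proof -
      have "(\<lambda>w. t w i) \<in> borel_measurable (PiM {..<N} (\<lambda>_. borel))"
        unfolding t_def by (rule measurable_angle) (use that in auto)
      moreover have "sets (PiM {..<N} W) = sets (PiM {..<N} (\<lambda>_. borel))"
        by (intro sets_PiM_cong W refl)
      ultimately show ?thesis by (simp cong: measurable_cong_sets)
    qed
    \<comment> \<open>The factor with \<open>w N\<close> is independent of the factor that involves the earlier coordinates only.\<close>
    have "\<Omega>.indep_var (PiM {N} W) (\<lambda>w. restrict w {N}) (PiM {..<N} W) (\<lambda>w. restrict w {..<N})"
      by (rule \<Omega>.indep_var_restrict[OF indep]) auto
    then have "\<Omega>.indep_var borel (?X1 \<circ> (\<lambda>w. restrict w {N})) borel (?X2 \<circ> (\<lambda>w. restrict w {..<N}))"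
    proof (rule \<Omega>.indep_var_compose)
      have "(\<lambda>w. w N) \<in> borel_measurable (PiM {N} W)"
        using measurable_component_singleton[of N "{N}" W] W(2)[of N] by (simp cong: measurable_cong_sets)
      then show "?X1 \<in> borel_measurable (PiM {N} W)" by measurable
      show "?X2 \<in> borel_measurable (PiM {..<N} W)"
        unfolding s_def u_def
        by (intro measurable_compose[OF _ borel_measurable_cis] borel_measurable_diff
            borel_measurable_divide borel_measurable_sum borel_measurable_times meas_t) auto
    qed
    moreover have "?X1 \<circ> (\<lambda>w. restrict w {N}) = ?X1" by auto
    moreover have "?X2 \<circ> (\<lambda>w. restrict w {..<N}) = ?X2"
      by (auto simp: s_def u_def local fun_eq_iff intro!: arg_cong[where f = cis] sum.cong)
    ultimately have ind: "\<Omega>.indep_var borel ?X1 borel ?X2" by simp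
    have m1: "?X1 \<in> borel_measurable \<Omega>" and m2: "?X2 \<in> borel_measurable \<Omega>"
      using \<Omega>.indep_var_rv1[OF ind] \<Omega>.indep_var_rv2[OF ind] by auto
    have "(\<integral>w. cis (2 * pi * (\<Sum>i<Suc N. n i * t w i)) \<partial>\<Omega>) = (\<integral>w. ?X1 w * ?X2 w \<partial>\<Omega>)"
      by (rule Bochner_Integration.integral_cong[OF refl])
        (simp only: top_split cis_mult ring_distribs)
    also have "\<dots> = (\<integral>w. ?X1 w \<partial>\<Omega>) * (\<integral>w. ?X2 w \<partial>\<Omega>)"
      by (rule \<Omega>.indep_var_lebesgue_integral[OF ind])
        (auto intro!: \<Omega>.integrable_const_bound[where B = 1] m1 m2)
    also have "(\<integral>w. ?X1 w \<partial>\<Omega>) = (\<integral>x. cis (2 * pi * (n N * x)) \<partial>distr \<Omega> (W N) (\<lambda>w. w N))"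
    proof (rule integral_distr[symmetric])
      show "(\<lambda>w. w N) \<in> measurable \<Omega> (W N)" unfolding \<Omega>_def by simp
      have "(\<lambda>x::real. cis (2 * pi * (n N * x))) \<in> borel_measurable borel" by measurable
      then show "(\<lambda>x. cis (2 * pi * (n N * x))) \<in> borel_measurable (W N)"
        using W(2)[of N] by (simp cong: measurable_cong_sets)
    qed
    also have "distr \<Omega> (W N) (\<lambda>w. w N) = W N"
      unfolding \<Omega>_def by (simp add: P.PiM_component)
    also have "(\<integral>x. cis (2 * pi * (n N * x)) \<partial>W N) = (if int (k N) dvd n N then 1 else 0)"
      by (rule W)
    finally have eq: "(\<integral>w. cis (2 * pi * (\<Sum>i<Suc N. n i * t w i)) \<partial>\<Omega>) =
        (if int (k N) dvd n N then 1 else 0) * (\<integral>w. ?X2 w \<partial>\<Omega>)" .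
    show ?case
    proof (cases "int (k N) dvd n N")
      case False
      then have "n \<notin> R" using dvd[of n N] Suc.prems by force
      then show ?thesis using eq False by simp
    next
      case True
      then have nN: "n N = q * int (k N)" by (simp add: q_def)
      have "n N * u w = (\<Sum>i<N. q * r N i * t w i)" for w
      proof (cases "k N = 0")
        case True
        then have "q = 0" by (simp add: q_def)
        then show ?thesis using nN by simp
      next
        case False
        then have "n N * u w = q * (\<Sum>i<N. r N i * t w i)" by (simp add: u_def nN)
        then show ?thesis by (simp add: sum_distrib_left mult.assoc)
      qed
      then have "s w - n N * u w = (\<Sum>i<N. n' i * t w i)" for w
        by (simp add: s_def n'_def sum_subtractf ring_distribs)
      moreover have "n' i = 0" if "N \<le> i" for i
        using that Suc.prems[of i] r(2)[of N i] r(3)[of N] nN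
        by (cases "i = N") (auto simp: n'_def)
      ultimately show ?thesis using eq True Suc.IH[of n'] n'_iff by simp
    qed
  qed
  define Z where "Z = (\<lambda>w i. cis (2 * pi * t w i))"
  have Z: "Z \<in> measurable \<Omega> borel"
    unfolding Z_def by (intro measurable_coordinatewise_then_product) measurable
  have "haar_law R (distr \<Omega> borel Z)"
    unfolding haar_law_def
  proof (intro conjI allI impI)
    show "prob_space (distr \<Omega> borel Z)" using Z by (rule \<Omega>.prob_space_distr)
    show "sets (distr \<Omega> borel Z) = sets borel" by simp
    have "AE w in \<Omega>. Z w \<in> torus" by (simp add: Z_def torus_def)
    then show "AE x in distr \<Omega> borel Z. x \<in> torus"
      using Z by (subst AE_distr_iff) auto
    fix n :: "nat \<Rightarrow> int" assume fin: "finite {i. n i \<noteq> 0}"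
    then obtain N where N: "\<And>i. n i \<noteq> 0 \<Longrightarrow> i < N"
      using finite_nat_set_iff_bounded by auto
    have N0: "n i = 0" if "N \<le> i" for i using N[of i] that by linarith
    have mono: "monomial n x = (\<Prod>i<N. x i powi n i)" for x
      by (rule monomial_eq_prod) (use N in auto)
    have "monomial n (Z w) = cis (2 * pi * (\<Sum>i<N. n i * t w i))" for w
    proof -
      have "2 * pi * (\<Sum>i<N. n i * t w i) = (\<Sum>i<N. n i * (2 * pi * t w i))"
        by (simp add: sum_distrib_left algebra_simps)
      then show ?thesis by (simp add: mono Z_def cis_sum cis_power_int)
    qed
    then show "(\<integral>x. monomial n x \<partial>distr \<Omega> borel Z) = (if n \<in> R then 1 else 0)"
      using Z main[OF N0] by (subst integral_distr) simp_all
  qed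
  then show ?thesis by blast
qed

section \<open>Fourier coefficients determine measures on the torus\<close>

lemma monomial_add:
  assumes "x \<in> torus" "finite {i. n i \<noteq> 0}" "finite {i. m i \<noteq> 0}"
  shows "monomial (\<lambda>i. n i + m i) x = monomial n x * monomial m x"
proof -
  define F where "F = {i. n i \<noteq> 0} \<union> {i. m i \<noteq> 0}"
  have F: "finite F" using assms by (simp add: F_def)
  have "norm (x i) = 1" for i using assms(1) by (simp add: torus_def)
  then have nz: "x i \<noteq> 0" for i by (metis norm_zero zero_neq_one)
  have "monomial (\<lambda>i. n i + m i) x = (\<Prod>i\<in>F. x i powi (n i + m i))"
    by (rule monomial_eq_prod[OF F]) (auto simp: F_def)
  also have "\<dots> = (\<Prod>i\<in>F. x i powi n i) * (\<Prod>i\<in>F. x i powi m i)"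
    by (simp add: power_int_add nz prod.distrib)
  also have "\<dots> = monomial n x * monomial m x"
    using F by (subst (1 2) monomial_eq_prod[of F]) (auto simp: F_def)
  finally show ?thesis .
qed

lemma norm_monomial: "x \<in> torus \<Longrightarrow> norm (monomial n x) = 1"
  unfolding monomial_def prod_norm[symmetric] by (rule prod.neutral) (simp add: torus_def norm_power_int)

lemma cnj_monomial: 
  assumes "x \<in> torus"
  shows "cnj (monomial n x) = monomial (\<lambda>i. - n i) x"
proof -
  have "x i * cnj (x i) = 1" for i
    using assms complex_norm_square[of "x i"] by (simp add: torus_def)
  then have "cnj (x i) = inverse (x i)" for i
    by (metis inverse_unique)
  then show ?thesis
    by (simp add: monomial_def power_int_minus power_int_inverse)
qed

text \<open>Trigonometric polynomials; closure under products holds only up to their values off the torus.\<close>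

inductive_set trig_poly :: "((nat \<Rightarrow> complex) \<Rightarrow> complex) set" where
  monomial: "finite {i. n i \<noteq> 0} \<Longrightarrow> (\<lambda>x. c * monomial n x) \<in> trig_poly"
| add: "f \<in> trig_poly \<Longrightarrow> g \<in> trig_poly \<Longrightarrow> (\<lambda>x. f x + g x) \<in> trig_poly"

lemma trig_poly_mult:
  assumes "f \<in> trig_poly" "g \<in> trig_poly"
  shows "\<exists>h\<in>trig_poly. \<forall>x\<in>torus. h x = f x * g x"
  using assms(1)
proof induction
  case (monomial n c)
  show ?case using assms(2)
  proof induction
    case (monomial m d)
    have "finite {i. n i + m i \<noteq> 0}"
      by (rule finite_subset[of _ "{i. n i \<noteq> 0} \<union> {i. m i \<noteq> 0}"])
        (use \<open>finite {i. n i \<noteq> 0}\<close> monomial in auto)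
    then have "(\<lambda>x. (c * d) * monomial (\<lambda>i. n i + m i) x) \<in> trig_poly" by (rule trig_poly.monomial)
    then show ?case 
      by (rule bexI[rotated]) (simp add: monomial_add \<open>finite {i. n i \<noteq> 0}\<close> monomial)
  next
    case (add f g)
    then obtain h h' where "h\<in>trig_poly" "\<forall>x\<in>torus. h x = c * monomial n x * f x"
      "h'\<in>trig_poly" "\<forall>x\<in>torus. h' x = c * monomial n x * g x" by blast
    then show ?case
      by (intro bexI[of _ "\<lambda>x. h x + h' x"]) (auto simp: ring_distribs intro: trig_poly.add)
  qed
next
  case (add f1 f2)
  then obtain h h' where "h\<in>trig_poly" "\<forall>x\<in>torus. h x = f1 x * g x"
      "h'\<in>trig_poly" "\<forall>x\<in>torus. h' x = f2 x * g x" by blast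
  then show ?case
    by (intro bexI[of _ "\<lambda>x. h x + h' x"]) (auto simp: ring_distribs intro: trig_poly.add)
qed

text \<open>The indicator of a closed set \<open>C\<close> is the decreasing limit of the continuous functions
  \<open>max 0 (1 - k * infdist x C)\<close>, and closed sets generate the Borel sets.\<close>

lemma finite_measure_eqI_continuous:
  fixes M N :: "'a::metric_space measure"
  assumes M: "finite_measure M" "sets M = sets borel" and N: "finite_measure N" "sets N = sets borel"
    and eq: "\<And>f :: 'a \<Rightarrow> real. continuous_on UNIV f \<Longrightarrow> (\<And>x. 0 \<le> f x \<and> f x \<le> 1) \<Longrightarrow>
      (\<integral>x. f x \<partial>M) = (\<integral>x. f x \<partial>N)"
  shows "M = N"
proof -
  interpret M: finite_measure M by fact
  interpret N: finite_measure N by fact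
  have lim: "(\<lambda>k. \<integral>x. max 0 (1 - real k * infdist x C) \<partial>K) \<longlonglongrightarrow> measure K C"
    if "finite_measure K" "sets K = sets borel" "closed C" "C \<noteq> {}" for K :: "'a measure" and C
  proof -
    interpret K: finite_measure K by fact
    have C: "C \<in> sets K" using that by simp
    have "(\<lambda>k. \<integral>x. max 0 (1 - real k * infdist x C) \<partial>K) \<longlonglongrightarrow> (\<integral>x. indicator C x \<partial>K)"
    proof (rule integral_dominated_convergence[where w = "\<lambda>_. 1"])
      show "(\<lambda>x. max 0 (1 - real k * infdist x C)) \<in> borel_measurable K" for k
        by (subst measurable_cong_sets[OF that(2) refl])
          (intro borel_measurable_continuous_onI continuous_intros)
      show "AE x in K. (\<lambda>k. max 0 (1 - real k * infdist x C)) \<longlonglongrightarrow> indicator C x"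
      proof (rule AE_I2)
        fix x
        show "(\<lambda>k. max 0 (1 - real k * infdist x C)) \<longlonglongrightarrow> indicator C x"
        proof (cases "x \<in> C")
          case False
          then have d: "infdist x C > 0"
            using that by (metis in_closed_iff_infdist_zero infdist_nonneg order_le_less)
          obtain k0 where "1 / infdist x C < real k0" using reals_Archimedean2 by blast
          then have "max 0 (1 - real k * infdist x C) = 0" if "k \<ge> k0" for k
          proof -
            have "1 / infdist x C \<le> real k" using \<open>_ < real k0\<close> that by linarith
            then show ?thesis using d by (simp add: field_simps)
          qed
          then show ?thesis using False
            by (intro tendsto_eventually) (auto simp: eventually_sequentially)
        qed simp
      qed
      show "AE x in K. norm (max 0 (1 - real k * infdist x C)) \<le> 1" for k
        by (simp add: infdist_nonneg)
    qed (use C in auto)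
    then show ?thesis using C by simp
  qed
  have closed_eq: "emeasure M C = emeasure N C" if "closed C" for C
  proof (cases "C = {}")
    case False
    have "(\<integral>x. max 0 (1 - real k * infdist x C) \<partial>M) = (\<integral>x. max 0 (1 - real k * infdist x C) \<partial>N)" for k
      by (rule eq) (auto intro!: continuous_intros simp: infdist_nonneg)
    then have "measure M C = measure N C"
      using lim[OF M that False] lim[OF N that False] by (simp add: LIMSEQ_unique)
    then show ?thesis by (simp add: M.emeasure_eq_measure N.emeasure_eq_measure)
  qed simp
  have sb: "sets (borel :: 'a measure) = sigma_sets UNIV (Collect closed)"
    unfolding borel_eq_closed by simp
  show ?thesis
  proof (rule measure_eqI_generator_eq[of "Collect closed" UNIV])
    show "Int_stable (Collect closed :: 'a set set)" by (auto simp: Int_stable_def)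
    show "range (\<lambda>_::nat. UNIV :: 'a set) \<subseteq> Collect closed" by auto
  qed (use M N closed_eq sb in \<open>auto simp: M.emeasure_eq_measure\<close>)
qed

lemma integrable_monomial:
  assumes "finite_measure M" "sets M = sets borel" "AE x in M. x \<in> torus"
  shows "integrable M (monomial n)"
proof (rule finite_measure.integrable_const_bound[OF assms(1), where B = 1])
  show "AE x in M. norm (monomial n x) \<le> 1"
    using assms(3) by eventually_elim (simp add: norm_monomial)
  show "monomial n \<in> borel_measurable M"
    using assms(2) by (simp cong: measurable_cong_sets)
qed

text \<open>By the Stone-Weierstrass theorem, real trigonometric polynomials are uniformly dense among the
  continuous functions on the compact torus.\<close>

lemma measure_eqI_monomial:
  assumes M: "finite_measure M" "sets M = sets borel" "AE x in M. x \<in> torus"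
    and N: "finite_measure N" "sets N = sets borel" "AE x in N. x \<in> torus"
    and eq: "\<And>n. finite {i. n i \<noteq> 0} \<Longrightarrow> (\<integral>x. monomial n x \<partial>M) = (\<integral>x. monomial n x \<partial>N)"
  shows "M = N"
proof (rule finite_measure_eqI_continuous[OF M(1,2) N(1,2)])
  fix f :: "(nat \<Rightarrow> complex) \<Rightarrow> real"
  assume cont: "continuous_on UNIV f" and bound: "\<And>x. 0 \<le> f x \<and> f x \<le> 1"
  have trig: "integrable M h \<and> integrable N h \<and> (\<integral>x. h x \<partial>M) = (\<integral>x. h x \<partial>N)" if "h \<in> trig_poly" for h
    using that
    by induction (simp_all add: integrable_monomial M N eq)
  define P where "P g \<longleftrightarrow> continuous_on torus g \<and> (\<exists>h\<in>trig_poly. \<forall>x\<in>torus. h x = complex_of_real (g x))"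
    for g :: "(nat \<Rightarrow> complex) \<Rightarrow> real"
  have approx: "\<exists>g. P g \<and> (\<forall>x\<in>torus. \<bar>f x - g x\<bar> < e)" if "e > 0" for e
  proof (rule Stone_Weierstrass_HOL[OF compact_torus])
    fix c :: real
    have "(\<lambda>x. complex_of_real c * monomial (\<lambda>_. 0) x) \<in> trig_poly" by (rule trig_poly.monomial) simp
    then show "P (\<lambda>x. c)" unfolding P_def by (auto simp: monomial_def intro: bexI[rotated])
  next
    fix g1 g2 :: "(nat \<Rightarrow> complex) \<Rightarrow> real" assume "P g1 \<and> P g2"
    then obtain h1 h2 where h: "h1 \<in> trig_poly" "h2 \<in> trig_poly" "continuous_on torus g1" "continuous_on torus g2"
      "\<forall>x\<in>torus. h1 x = complex_of_real (g1 x)" "\<forall>x\<in>torus. h2 x = complex_of_real (g2 x)"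
      by (auto simp: P_def)
    show "P (\<lambda>x. g1 x + g2 x)"
      unfolding P_def using h
      by (intro conjI continuous_intros bexI[OF _ trig_poly.add[OF h(1,2)]]) auto
    obtain h where "h \<in> trig_poly" "\<forall>x\<in>torus. h x = h1 x * h2 x"
      using trig_poly_mult[OF h(1,2)] by blast
    then show "P (\<lambda>x. g1 x * g2 x)"
      unfolding P_def using h by (intro conjI continuous_intros bexI[of _ h]) auto
  next
    fix x y :: "nat \<Rightarrow> complex" assume xy: "x \<in> torus \<and> y \<in> torus \<and> x \<noteq> y"
    then obtain j where "x j \<noteq> y j" by auto
    define n where "n = (\<lambda>i. if i = j then 1 else 0 :: int)"
    have n: "monomial n x = x j" "finite {i. n i \<noteq> 0}" for x
      by (auto simp: monomial_eq_prod[of "{j}"] n_def)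
    have m: "monomial (\<lambda>i. - n i) x = cnj (x j)" if "x \<in> torus" for x
      using cnj_monomial[OF that, of n] by (simp add: n)
    \<comment> \<open>Real parts of multiples of coordinates separate points.\<close>
    have "P (\<lambda>x. Re (c * x j))" for c
    proof -
      have "(\<lambda>x. c / 2 * monomial n x + cnj c / 2 * monomial (\<lambda>i. - n i) x) \<in> trig_poly"
        by (intro trig_poly.intros) (simp_all add: n)
      moreover have "continuous_on torus (\<lambda>x. Re (c * x j))"
        by (intro continuous_intros continuous_on_subset[OF continuous_on_product_coordinates subset_UNIV])
      ultimately show ?thesis
        unfolding P_def by (intro conjI bexI) (auto simp: n m complex_eq_iff add_divide_distrib[symmetric])
    qed
    moreover have "Re (1 * x j) \<noteq> Re (1 * y j) \<or> Re (\<i> * x j) \<noteq> Re (\<i> * y j)"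
      using \<open>x j \<noteq> y j\<close> by (auto simp: complex_eq_iff)
    ultimately show "\<exists>g. P g \<and> g x \<noteq> g y" by blast
  next
    show "continuous_on torus f" using cont by (rule continuous_on_subset) simp
    show "continuous_on torus g" if "P g" for g using that by (simp add: P_def)
  qed fact
  have dist: "norm ((\<integral>x. complex_of_real (f x) \<partial>K) - (\<integral>x. h x \<partial>K)) \<le> e * measure K UNIV"
    if K: "finite_measure K" "sets K = sets borel" "AE x in K. x \<in> torus" and "integrable K h"
      and close: "\<And>x. x \<in> torus \<Longrightarrow> norm (of_real (f x) - h x) \<le> e" for K h e
  proof -
    interpret K: finite_measure K by fact
    have f: "integrable K (\<lambda>x. complex_of_real (f x))"
      using borel_measurable_continuous_onI[OF cont] bound K(2)
      by (intro K.integrable_const_bound[where B = 1]) (auto cong: measurable_cong_sets)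
    have "norm ((\<integral>x. complex_of_real (f x) \<partial>K) - (\<integral>x. h x \<partial>K)) = norm (\<integral>x. of_real (f x) - h x \<partial>K)"
      using f \<open>integrable K h\<close> by simp
    also have "\<dots> \<le> (\<integral>x. norm (of_real (f x) - h x) \<partial>K)" by (rule integral_norm_bound)
    also have "\<dots> \<le> (\<integral>x. e \<partial>K)"
      using f \<open>integrable K h\<close> K(3)
      by (intro integral_mono_AE) (auto elim!: eventually_mono intro: close)
    also have "\<dots> = e * measure K UNIV"
      using sets_eq_imp_space_eq[OF K(2)] by simp
    finally show ?thesis .
  qed
  define C where "C = measure M UNIV + measure N UNIV"
  have small: "norm ((\<integral>x. complex_of_real (f x) \<partial>M) - (\<integral>x. complex_of_real (f x) \<partial>N)) \<le> e * C" if "e > 0" for e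
  proof -
    have "\<exists>g. P g \<and> (\<forall>x\<in>torus. \<bar>f x - g x\<bar> < e)" using that by (rule approx)
    then obtain g where g: "P g" "\<forall>x\<in>torus. \<bar>f x - g x\<bar> < e" by blast
    then obtain h where h: "h \<in> trig_poly" "\<forall>x\<in>torus. h x = complex_of_real (g x)" by (auto simp: P_def)
    have "norm (of_real (f x) - h x) \<le> e" if "x \<in> torus" for x
      using that g h by (simp flip: of_real_diff add: less_imp_le)
    then have "norm ((\<integral>x. complex_of_real (f x) \<partial>M) - (\<integral>x. h x \<partial>M)) \<le> e * measure M UNIV"
      "norm ((\<integral>x. complex_of_real (f x) \<partial>N) - (\<integral>x. h x \<partial>M)) \<le> e * measure N UNIV"
      using dist[OF M, of h e] dist[OF N, of h e] trig[OF h(1)] by auto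
    from norm_triangle_le_diff[OF add_mono[OF this]] show ?thesis
      by (simp add: C_def distrib_left)
  qed
  have "norm ((\<integral>x. complex_of_real (f x) \<partial>M) - (\<integral>x. complex_of_real (f x) \<partial>N)) \<le> 0"
  proof (rule field_le_epsilon)
    fix e :: real assume "e > 0"
    have C: "C \<ge> 0" by (simp add: C_def)
    then have "e / (C + 1) > 0" using \<open>e > 0\<close> by simp
    from small[OF this] have "norm ((\<integral>x. complex_of_real (f x) \<partial>M) - (\<integral>x. complex_of_real (f x) \<partial>N)) \<le> e / (C + 1) * C" .
    also have "\<dots> \<le> e" using C \<open>e > 0\<close> by (simp add: field_simps)
    finally show "norm ((\<integral>x. complex_of_real (f x) \<partial>M) - (\<integral>x. complex_of_real (f x) \<partial>N)) \<le> 0 + e" by simp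
  qed
  then show "(\<integral>x. f x \<partial>M) = (\<integral>x. f x \<partial>N)"
    by (simp only: norm_le_zero_iff right_minus_eq integral_complex_of_real of_real_eq_iff)
qed

text \<open>The measure is carried by the subgroup, because the mean of \<open>monomial n\<close> is \<open>1\<close> for \<open>n \<in> R\<close> and
  \<open>R\<close> is countable. The indicator of the torus enforces the bound \<open>1\<close> everywhere.\<close>

lemma haar_law_AE_monomial_eq_1:
  assumes "relation_group R" "haar_law R \<mu>"
  shows "AE x in \<mu>. \<forall>n\<in>R. monomial n x = 1"
proof -
  interpret prob_space \<mu> using assms by (simp add: haar_law_def)
  have fin: "finite {i. n i \<noteq> 0}" if "n \<in> R" for n using that assms by (simp add: relation_group_def)
  have [measurable]: "monomial n \<in> borel_measurable \<mu>" for n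
    using assms by (simp add: haar_law_def cong: measurable_cong_sets)
  have AE_torus: "AE x in \<mu>. x \<in> torus" using assms by (simp add: haar_law_def)
  have "AE x in \<mu>. monomial n x = 1" if n: "n \<in> R" for n
  proof -
    have "(\<integral>x. indicator torus x *\<^sub>R monomial n x \<partial>\<mu>) = (\<integral>x. monomial n x \<partial>\<mu>)"
    proof (rule integral_cong_AE)
      show "AE x in \<mu>. indicator torus x *\<^sub>R monomial n x = monomial n x"
        using AE_torus by eventually_elim simp
    qed (use assms in \<open>auto simp: haar_law_def intro!: borel_measurable_scaleR borel_measurable_indicator\<close>)
    also have "\<dots> = 1" using assms n fin by (simp add: haar_law_def)
    finally have "AE x in \<mu>. indicator torus x *\<^sub>R monomial n x = 1"
      by (intro AE_eq_1_if_expectation_eq_1)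
        (use assms in \<open>auto simp: haar_law_def norm_monomial indicator_def intro!: borel_measurable_scaleR borel_measurable_indicator\<close>)
    then show ?thesis using AE_torus by eventually_elim simp
  qed
  moreover have "countable R"
  proof (rule countable_subset)
    show "R \<subseteq> {n. finite {i. n i \<noteq> 0}}" using fin by auto
    show "countable {n :: nat \<Rightarrow> int. finite {i. n i \<noteq> 0}}"
    proof -
      have "{n :: nat \<Rightarrow> int. finite {i. n i \<noteq> 0}} \<subseteq> range (\<lambda>xs i. if i < length xs then xs ! i else 0)"
      proof
        fix n :: "nat \<Rightarrow> int" assume "n \<in> {n. finite {i. n i \<noteq> 0}}"
        then obtain N where N: "\<And>i. n i \<noteq> 0 \<Longrightarrow> i < N"
          using finite_nat_set_iff_bounded[of "{i. n i \<noteq> 0}"] by auto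
        have "n = (\<lambda>i. if i < length (map n [0..<N]) then map n [0..<N] ! i else 0)"
          using N by (auto simp: fun_eq_iff)
        then show "n \<in> range (\<lambda>xs i. if i < length xs then xs ! i else 0)" by blast
      qed
      then show ?thesis by (rule countable_subset) simp
    qed
  qed
  ultimately show ?thesis by (simp add: AE_ball_countable)
qed

section \<open>Affine maps and invariant sets\<close>

text \<open>For \<open>c\<close> in the torus and bijective \<open>\<tau>\<close>, an affine automorphism: it permutes coordinates and rotates.\<close>

definition affine_map :: "(nat \<Rightarrow> complex) \<Rightarrow> (nat \<Rightarrow> nat) \<Rightarrow> (nat \<Rightarrow> complex) \<Rightarrow> nat \<Rightarrow> complex" where
  "affine_map c \<tau> x i = c i * x (\<tau> i)"

lemma affine_map_torus: "c \<in> torus \<Longrightarrow> x \<in> torus \<Longrightarrow> affine_map c \<tau> x \<in> torus"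
  by (simp add: torus_def affine_map_def norm_mult)

lemma measurable_affine_map [measurable]: "affine_map c \<tau> \<in> borel_measurable borel"
proof (rule measurable_coordinatewise_then_product)
  have "(\<lambda>x :: nat \<Rightarrow> complex. x (\<tau> i)) \<in> borel_measurable borel" for i
    by (rule borel_measurable_coordinate)
  then show "(\<lambda>x. affine_map c \<tau> x i) \<in> borel_measurable borel" for i
    unfolding affine_map_def by (intro borel_measurable_times borel_measurable_const)
qed

lemma finite_support_reindex:
  assumes "finite {i. n i \<noteq> (0::int)}" "\<And>i. \<tau> (\<tau>' i) = i"
  shows "finite {i. n (\<tau>' i) \<noteq> 0}"
proof (rule finite_subset[OF _ finite_imageI[OF assms(1), of \<tau>]], rule subsetI)
  fix i assume "i \<in> {i. n (\<tau>' i) \<noteq> 0}"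
  then have "\<tau> (\<tau>' i) \<in> \<tau> ` {i. n i \<noteq> 0}" by (intro imageI) simp
  then show "i \<in> \<tau> ` {i. n i \<noteq> 0}" by (simp add: assms(2))
qed

lemma monomial_affine_map:
  assumes "\<And>i. \<tau> (\<tau>' i) = i" "\<And>i. \<tau>' (\<tau> i) = i"
  shows "monomial n (affine_map c \<tau> x) = monomial n c * monomial (\<lambda>i. n (\<tau>' i)) x"
proof -
  have "monomial n (affine_map c \<tau> x) = monomial n c * (\<Prod>i | n i \<noteq> 0. x (\<tau> i) powi n i)"
    by (simp add: monomial_def affine_map_def power_int_mult_distrib prod.distrib)
  also have "(\<Prod>i | n i \<noteq> 0. x (\<tau> i) powi n i) = monomial (\<lambda>i. n (\<tau>' i)) x"
    unfolding monomial_def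
    by (rule prod.reindex_bij_witness[where i = \<tau>' and j = \<tau>]) (simp_all add: assms)
  finally show ?thesis .
qed

context
  fixes R \<mu> assumes \<mu>: "haar_law R \<mu>"
begin

lemma haar_law_prob_space: "prob_space \<mu>"
  and haar_law_sets: "sets \<mu> = sets borel"
  and haar_law_space: "space \<mu> = UNIV"
  and haar_law_AE_torus: "AE x in \<mu>. x \<in> torus"
  and haar_law_integral: "finite {i. n i \<noteq> 0} \<Longrightarrow> (\<integral>x. monomial n x \<partial>\<mu>) = (if n \<in> R then 1 else 0)"
  using \<mu> sets_eq_imp_space_eq[of \<mu> borel] by (auto simp: haar_law_def)

lemma haar_law_measurable: "measurable \<mu> N = measurable borel N"
  by (rule measurable_cong_sets[OF haar_law_sets refl])

lemma haar_law_integrable_monomial: "integrable \<mu> (monomial n)"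
  by (intro integrable_monomial haar_law_sets haar_law_AE_torus prob_space.finite_measure haar_law_prob_space)

lemma haar_law_integrable_indicator_monomial:
  assumes "E \<in> sets \<mu>"
  shows "integrable \<mu> (\<lambda>x. indicator E x *\<^sub>R monomial n x)"
  by (rule integrable_mult_indicator[OF assms haar_law_integrable_monomial])

text \<open>An affine map permutes the monomials up to scalars; the hypotheses say that it maps \<open>R\<close> to itself
  with trivial scalars, so that it preserves all Fourier coefficients.\<close>

lemma measure_preserving_affine_map:
  assumes c: "c \<in> torus" and \<tau>: "\<And>i. \<tau> (\<tau>' i) = i" "\<And>i. \<tau>' (\<tau> i) = i"
    and R: "\<And>n. finite {i. n i \<noteq> 0} \<Longrightarrow> (\<lambda>i. n (\<tau>' i)) \<in> R \<longleftrightarrow> n \<in> R"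
    and trivial: "\<And>n. n \<in> R \<Longrightarrow> monomial n c = 1"
  shows "measure_preserving_map \<mu> (affine_map c \<tau>)"
  unfolding measure_preserving_map_def
proof
  have meas: "affine_map c \<tau> \<in> measurable \<mu> borel" unfolding haar_law_measurable by simp
  then show "affine_map c \<tau> \<in> measurable \<mu> \<mu>"
    using measurable_cong_sets[OF refl haar_law_sets] by blast
  have "distr \<mu> borel (affine_map c \<tau>) = \<mu>"
  proof (rule measure_eqI_monomial)
    interpret prob_space \<mu> by (rule haar_law_prob_space)
    interpret D: prob_space "distr \<mu> borel (affine_map c \<tau>)" using meas by (rule prob_space_distr)
    show "finite_measure (distr \<mu> borel (affine_map c \<tau>))" "finite_measure \<mu>" by unfold_locales
    have "AE x in \<mu>. affine_map c \<tau> x \<in> torus"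
      using haar_law_AE_torus by eventually_elim (rule affine_map_torus[OF c])
    then show "AE x in distr \<mu> borel (affine_map c \<tau>). x \<in> torus"
      using meas by (subst AE_distr_iff) auto
    fix n :: "nat \<Rightarrow> int" assume n: "finite {i. n i \<noteq> 0}"
    have "(\<integral>x. monomial n x \<partial>distr \<mu> borel (affine_map c \<tau>)) = (\<integral>x. monomial n (affine_map c \<tau> x) \<partial>\<mu>)"
      using meas by (intro integral_distr) auto
    also have "\<dots> = monomial n c * (\<integral>x. monomial (\<lambda>i. n (\<tau>' i)) x \<partial>\<mu>)"
      by (simp add: monomial_affine_map[OF \<tau>])
    also have "\<dots> = monomial n c * (if n \<in> R then 1 else 0)"
      using haar_law_integral[OF finite_support_reindex[of n \<tau> \<tau>', OF n \<tau>(1)]] R[OF n] by simp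
    also have "\<dots> = (\<integral>x. monomial n x \<partial>\<mu>)" using trivial haar_law_integral[OF n] by simp
    finally show "(\<integral>x. monomial n x \<partial>distr \<mu> borel (affine_map c \<tau>)) = (\<integral>x. monomial n x \<partial>\<mu>)" .
  qed (simp_all add: haar_law_sets haar_law_AE_torus)
  moreover have "distr \<mu> \<mu> (affine_map c \<tau>) = distr \<mu> borel (affine_map c \<tau>)"
    by (rule distr_cong) (simp_all add: haar_law_sets)
  ultimately show "distr \<mu> \<mu> (affine_map c \<tau>) = \<mu>" by simp
qed

text \<open>The monomials with index in \<open>R\<close> are \<open>1\<close> almost everywhere, so under the hypothesis the restriction of
  \<open>\<mu>\<close> to \<open>E\<close> has the same coefficients as the multiple \<open>\<mu> E \<cdot> \<mu>\<close>. Hence both measures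
  agree, and evaluating them on the complement of \<open>E\<close> gives \<open>0 = \<mu> E (1 - \<mu> E)\<close>.\<close>

lemma haar_law_trivial_if_coefficients_vanish:
  assumes R: "relation_group R" and E: "E \<in> sets \<mu>"
    and vanish: "\<And>n. finite {i. n i \<noteq> 0} \<Longrightarrow> n \<notin> R \<Longrightarrow> (\<integral>x. indicator E x *\<^sub>R monomial n x \<partial>\<mu>) = 0"
  shows "measure \<mu> E = 0 \<or> measure \<mu> E = 1"
proof -
  interpret prob_space \<mu> by (rule haar_law_prob_space)
  note [measurable] = E
  let ?M = "density \<mu> (\<lambda>x. ennreal (indicator E x))" and ?N = "density \<mu> (\<lambda>x. ennreal (prob E))"
  have mono: "monomial n \<in> borel_measurable \<mu>" for n unfolding haar_law_measurable by simp
  have emM: "emeasure ?M B = emeasure \<mu> (E \<inter> B)" if "B \<in> sets \<mu>" for B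
  proof -
    have "emeasure ?M B = (\<integral>\<^sup>+x. ennreal (indicator E x) * indicator B x \<partial>\<mu>)"
      by (rule emeasure_density) (use that in measurable)
    also have "\<dots> = (\<integral>\<^sup>+x. indicator (E \<inter> B) x \<partial>\<mu>)"
      by (rule nn_integral_cong) (simp split: split_indicator)
    also have "\<dots> = emeasure \<mu> (E \<inter> B)" by (rule nn_integral_indicator) (use that in measurable)
    finally show ?thesis .
  qed
  have emN: "emeasure ?N B = prob E * prob B" if "B \<in> sets \<mu>" for B
    using that by (simp add: emeasure_density_const emeasure_eq_measure ennreal_mult)
  have "?M = ?N"
  proof (rule measure_eqI_monomial)
    show "finite_measure ?M" "finite_measure ?N"
      using emM[OF sets.top] emN[OF sets.top] by (auto intro!: finite_measureI)
    show "AE x in ?M. x \<in> torus" "AE x in ?N. x \<in> torus"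
      using haar_law_AE_torus by (auto simp: AE_density)
    fix n :: "nat \<Rightarrow> int" assume n: "finite {i. n i \<noteq> 0}"
    have M: "(\<integral>x. monomial n x \<partial>?M) = (\<integral>x. indicator E x *\<^sub>R monomial n x \<partial>\<mu>)"
      by (rule integral_density) (use mono in auto)
    have N: "(\<integral>x. monomial n x \<partial>?N) = (\<integral>x. prob E *\<^sub>R monomial n x \<partial>\<mu>)"
      by (rule integral_density) (use mono in auto)
    show "(\<integral>x. monomial n x \<partial>?M) = (\<integral>x. monomial n x \<partial>?N)"
    proof (cases "n \<in> R")
      case False
      then show ?thesis using n by (simp add: M N vanish haar_law_integral)
    next
      case True
      have "(\<integral>x. indicator E x *\<^sub>R monomial n x \<partial>\<mu>) = (\<integral>x. of_real (indicator E x) \<partial>\<mu>)"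
      proof (rule integral_cong_AE)
        show "AE x in \<mu>. indicator E x *\<^sub>R monomial n x = of_real (indicator E x)"
          using haar_law_AE_monomial_eq_1[OF R \<mu>] by eventually_elim (simp add: True scaleR_conv_of_real)
      qed (use mono E in measurable)
      then show ?thesis using True n E by (simp add: M N haar_law_integral scaleR_conv_of_real)
    qed
  qed (simp_all add: haar_law_sets)
  then have "emeasure ?M (space \<mu> - E) = emeasure ?N (space \<mu> - E)" by simp
  then have "prob E * prob (space \<mu> - E) = 0"
    by (simp add: emM emN)
  then show ?thesis by (auto simp: prob_compl)
qed

lemma integral_indicator_monomial_invariant:
  assumes T: "measure_preserving_map \<mu> T" and E: "E \<in> sets \<mu>" and inv: "AE x in \<mu>. T x \<in> E \<longleftrightarrow> x \<in> E"
  shows "(\<integral>x. indicator E x *\<^sub>R monomial n (T x) \<partial>\<mu>) = (\<integral>x. indicator E x *\<^sub>R monomial n x \<partial>\<mu>)"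
proof -
  note [measurable] = E
  have [measurable]: "monomial n \<in> borel_measurable \<mu>" unfolding haar_law_measurable by simp
  have [measurable]: "T \<in> measurable \<mu> \<mu>" and d: "distr \<mu> \<mu> T = \<mu>" using T by (auto simp: measure_preserving_map_def)
  have "(\<integral>x. indicator E x *\<^sub>R monomial n x \<partial>\<mu>) = (\<integral>x. indicator E x *\<^sub>R monomial n x \<partial>distr \<mu> \<mu> T)"
    by (simp add: d)
  also have "\<dots> = (\<integral>x. indicator E (T x) *\<^sub>R monomial n (T x) \<partial>\<mu>)"
    by (rule integral_distr) measurable
  also have "\<dots> = (\<integral>x. indicator E x *\<^sub>R monomial n (T x) \<partial>\<mu>)"
  proof (rule integral_cong_AE)
    have m: "(\<lambda>x. monomial n (T x)) \<in> borel_measurable \<mu>"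
      by (rule measurable_compose[of T \<mu> \<mu>]) measurable
    have "(\<lambda>x. indicator E (T x) :: real) \<in> borel_measurable \<mu>"
      by (rule measurable_compose[of T \<mu> \<mu>]) measurable
    then show "(\<lambda>x. indicator E (T x) *\<^sub>R monomial n (T x)) \<in> borel_measurable \<mu>"
      using m by (rule borel_measurable_scaleR)
    show "(\<lambda>x. indicator E x *\<^sub>R monomial n (T x)) \<in> borel_measurable \<mu>"
      by (intro borel_measurable_scaleR borel_measurable_indicator E m)
    show "AE x in \<mu>. indicator E (T x) *\<^sub>R monomial n (T x) = indicator E x *\<^sub>R monomial n (T x)"
      using inv by eventually_elim (simp add: indicator_def)
  qed
  finally show ?thesis by simp
qed

end

section \<open>Square summability of coefficients\<close>

lemma relation_group_zero: "relation_group {\<lambda>_. 0}"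
  by (auto simp: relation_group_def)

text \<open>Bessel's inequality for the indicator of \<open>E\<close>: expand the square norm of its difference from \<open>h\<close>,
  its projection to the span of the orthonormal family of the monomials in \<open>S\<close>.\<close>

lemma haar_law_bessel:
  assumes \<mu>: "haar_law {\<lambda>_. 0} \<mu>" and E: "E \<in> sets \<mu>"
    and S: "finite S" "\<And>n. n \<in> S \<Longrightarrow> finite {i. n i \<noteq> 0}"
  shows "(\<Sum>n\<in>S. (cmod (\<integral>x. indicator E x *\<^sub>R monomial n x \<partial>\<mu>))\<^sup>2) \<le> 1"
proof -
  interpret prob_space \<mu> by (rule haar_law_prob_space[OF \<mu>])
  note [measurable] = E
  have [measurable]: "monomial n \<in> borel_measurable \<mu>" for n
    unfolding haar_law_measurable[OF \<mu>] by simp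
  define v where "v n = (\<integral>x. indicator E x *\<^sub>R monomial n x \<partial>\<mu>)" for n
  define h where "h x = (\<Sum>n\<in>S. cnj (v n) * monomial n x)" for x
  define s where "s = (\<Sum>n\<in>S. (cmod (v n))\<^sup>2)"
  have int_mono: "integrable \<mu> (monomial n)" for n by (rule haar_law_integrable_monomial[OF \<mu>])
  have h_meas: "h \<in> borel_measurable \<mu>" unfolding h_def[abs_def] by measurable
  have h_sq_meas: "(\<lambda>x. of_real ((cmod (h x))\<^sup>2) :: complex) \<in> borel_measurable \<mu>"
    by (rule measurable_compose[OF h_meas]) measurable
  have h_ind: "integrable \<mu> (\<lambda>x. indicator E x *\<^sub>R h x)" "(\<integral>x. indicator E x *\<^sub>R h x \<partial>\<mu>) = of_real s"
  proof -
    have eq: "(\<lambda>x. indicator E x *\<^sub>R h x) = (\<lambda>x. \<Sum>n\<in>S. cnj (v n) * (indicator E x *\<^sub>R monomial n x))"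
      by (simp add: h_def scaleR_sum_right)
    note i = haar_law_integrable_indicator_monomial[OF \<mu> E]
    show "integrable \<mu> (\<lambda>x. indicator E x *\<^sub>R h x)" unfolding eq by (intro Bochner_Integration.integrable_sum integrable_mult_right i)
    have "(\<integral>x. indicator E x *\<^sub>R h x \<partial>\<mu>) =
        (\<Sum>n\<in>S. \<integral>x. cnj (v n) * (indicator E x *\<^sub>R monomial n x) \<partial>\<mu>)"
      unfolding eq by (intro Bochner_Integration.integral_sum integrable_mult_right i)
    also have "\<dots> = (\<Sum>n\<in>S. cnj (v n) * v n)"
      by (simp only: integral_mult_right_zero v_def)
    also have "\<dots> = of_real s" by (simp only: s_def of_real_sum complex_norm_square mult.commute)
    finally show "(\<integral>x. indicator E x *\<^sub>R h x \<partial>\<mu>) = of_real s" .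
  qed
  have h_sq: "integrable \<mu> (\<lambda>x. of_real ((cmod (h x))\<^sup>2) :: complex)" "(\<integral>x. of_real ((cmod (h x))\<^sup>2) \<partial>\<mu>) = complex_of_real s"
  proof -
    let ?f = "\<lambda>x. \<Sum>n\<in>S. \<Sum>m\<in>S. (cnj (v n) * v m) * monomial (\<lambda>i. n i - m i) x"
    have AE: "AE x in \<mu>. ?f x = of_real ((cmod (h x))\<^sup>2)"
      using haar_law_AE_torus[OF \<mu>]
    proof eventually_elim
      case (elim x)
      have "monomial (\<lambda>i. n i - m i) x = monomial n x * cnj (monomial m x)" if "n \<in> S" "m \<in> S" for n m
        using monomial_add[OF elim S(2)[OF that(1)], of "\<lambda>i. - m i"] S(2)[OF that(2)]
        by (simp add: cnj_monomial[OF elim])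
      then have "?f x = (\<Sum>n\<in>S. \<Sum>m\<in>S. (cnj (v n) * monomial n x) * cnj (cnj (v m) * monomial m x))"
        by (intro sum.cong) (simp_all add: algebra_simps)
      also have "\<dots> = h x * cnj (h x)" by (simp add: h_def sum_product)
      finally show ?case by (simp only: complex_norm_square)
    qed
    have int: "integrable \<mu> ?f" by (intro Bochner_Integration.integrable_sum integrable_mult_right int_mono)
    then show "integrable \<mu> (\<lambda>x. of_real ((cmod (h x))\<^sup>2) :: complex)"
      by (rule integrable_cong_AE_imp[OF _ h_sq_meas AE])
    have mm: "(\<integral>x. monomial (\<lambda>i. n i - m i) x \<partial>\<mu>) = (if n = m then 1 else 0)" if "n \<in> S" "m \<in> S" for n m
    proof -
      have "finite {i. n i - m i \<noteq> 0}"
        by (rule finite_subset[OF _ finite_UnI[OF S(2)[OF that(1)] S(2)[OF that(2)]]]) auto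
      then show ?thesis using haar_law_integral[OF \<mu>] by (auto simp: fun_eq_iff)
    qed
    have "(\<integral>x. of_real ((cmod (h x))\<^sup>2) \<partial>\<mu>) = (\<integral>x. ?f x \<partial>\<mu>)"
      by (rule integral_cong_AE[OF h_sq_meas borel_measurable_integrable[OF int]])
        (use AE in \<open>auto elim: eventually_mono\<close>)
    also have "\<dots> = (\<Sum>n\<in>S. \<Sum>m\<in>S. (cnj (v n) * v m) * (\<integral>x. monomial (\<lambda>i. n i - m i) x \<partial>\<mu>))"
      by (simp add: Bochner_Integration.integral_sum int_mono)
    also have "\<dots> = (\<Sum>n\<in>S. cnj (v n) * v n)"
    proof (rule sum.cong)
      fix n assume n: "n \<in> S"
      have "(\<Sum>m\<in>S. (cnj (v n) * v m) * (\<integral>x. monomial (\<lambda>i. n i - m i) x \<partial>\<mu>)) =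
          (\<Sum>m\<in>S. if n = m then cnj (v n) * v m else 0)"
        by (rule sum.cong) (simp_all add: mm n)
      then show "(\<Sum>m\<in>S. (cnj (v n) * v m) * (\<integral>x. monomial (\<lambda>i. n i - m i) x \<partial>\<mu>)) = cnj (v n) * v n"
        using S n by simp
    qed simp
    also have "\<dots> = of_real s" by (simp only: s_def of_real_sum complex_norm_square mult.commute)
    finally show "(\<integral>x. of_real ((cmod (h x))\<^sup>2) \<partial>\<mu>) = complex_of_real s" .
  qed
  have sq: "(cmod (of_real (indicator E x) - h x))\<^sup>2 =
      indicator E x - 2 * Re (indicator E x *\<^sub>R h x) + (cmod (h x))\<^sup>2" for x
    by (cases "x \<in> E") (simp_all add: cmod_power2 power2_diff)
  have "0 \<le> (\<integral>x. (cmod (of_real (indicator E x) - h x))\<^sup>2 \<partial>\<mu>)" by simp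
  also have "\<dots> = prob E - 2 * s + s"
  proof -
    have 1: "integrable \<mu> (\<lambda>x. (cmod (h x))\<^sup>2)" "(\<integral>x. (cmod (h x))\<^sup>2 \<partial>\<mu>) = s"
      using h_sq complex_of_real_integrable_eq by (auto simp flip: of_real_power)
    have 2: "integrable \<mu> (\<lambda>x. Re (indicator E x *\<^sub>R h x))" "(\<integral>x. Re (indicator E x *\<^sub>R h x) \<partial>\<mu>) = s"
      using integrable_Re[OF h_ind(1)] integral_Re[OF h_ind(1)] h_ind(2) by auto
    have 3: "integrable \<mu> (\<lambda>x. indicator E x :: real)"
      by (rule integrable_real_indicator[OF E]) (simp add: emeasure_eq_measure)
    have "(\<integral>x. (cmod (of_real (indicator E x) - h x))\<^sup>2 \<partial>\<mu>) =
        (\<integral>x. indicator E x - 2 * Re (indicator E x *\<^sub>R h x) \<partial>\<mu>) + (\<integral>x. (cmod (h x))\<^sup>2 \<partial>\<mu>)"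
      unfolding sq by (intro Bochner_Integration.integral_add Bochner_Integration.integrable_diff
          integrable_mult_right 1 2 3)
    also have "(\<integral>x. indicator E x - 2 * Re (indicator E x *\<^sub>R h x) \<partial>\<mu>) =
        (\<integral>x. indicator E x \<partial>\<mu>) - (\<integral>x. 2 * Re (indicator E x *\<^sub>R h x) \<partial>\<mu>)"
      by (intro Bochner_Integration.integral_diff integrable_mult_right 2 3)
    also have "(\<integral>x. 2 * Re (indicator E x *\<^sub>R h x) \<partial>\<mu>) = 2 * s"
      using 2(2) by (simp only: integral_mult_right_zero)
    finally show ?thesis using E 1(2) by simp
  qed
  finally have "s \<le> prob E" by simp
  then show ?thesis unfolding s_def v_def using prob_le_1[of E] by linarith
qed

text \<open>This applies to the coefficients along an infinite orbit of a group acting by affine maps.\<close>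

lemma haar_law_constant_coefficients_zero:
  assumes \<mu>: "haar_law {\<lambda>_. 0} \<mu>" and E: "E \<in> sets \<mu>"
    and S: "infinite S" "\<And>n. n \<in> S \<Longrightarrow> finite {i. n i \<noteq> 0}"
    and v: "\<And>n. n \<in> S \<Longrightarrow> cmod (\<integral>x. indicator E x *\<^sub>R monomial n x \<partial>\<mu>) = v"
  shows "v = 0"
proof (rule ccontr)
  assume "v \<noteq> 0"
  then obtain N :: nat where "1 / v\<^sup>2 < N" using reals_Archimedean2 by blast
  then have N: "1 < N * v\<^sup>2" using \<open>v \<noteq> 0\<close> by (simp add: field_simps)
  obtain S' where S': "S' \<subseteq> S" "finite S'" "card S' = N"
    using infinite_arbitrarily_large[OF S(1)] by blast
  have "(\<Sum>n\<in>S'. (cmod (\<integral>x. indicator E x *\<^sub>R monomial n x \<partial>\<mu>))\<^sup>2) \<le> 1"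
    by (rule haar_law_bessel[OF \<mu> E S'(2)]) (use S S' in auto)
  moreover have "(\<Sum>n\<in>S'. (cmod (\<integral>x. indicator E x *\<^sub>R monomial n x \<partial>\<mu>))\<^sup>2) = (\<Sum>n\<in>S'. v\<^sup>2)"
    by (rule sum.cong) (use v S' in auto)
  ultimately show False using N S' by simp
qed

text \<open>On the set \<open>E\<close> where the relation holds, all monomials \<open>(x\<^sub>i / x\<^sub>j)\<^sup>k\<close> are constants of modulus
  \<open>1\<close>, so their coefficients all have modulus \<open>\<mu> E\<close>.\<close>

lemma haar_law_AE_coordinates_unrelated:
  assumes \<mu>: "haar_law {\<lambda>_. 0} \<mu>" and "i \<noteq> j" and c: "cmod c = 1"
  shows "AE x in \<mu>. x i \<noteq> c * x j"
proof -
  interpret prob_space \<mu> by (rule haar_law_prob_space[OF \<mu>])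
  define E where "E = {x \<in> torus. x i = c * x j}"
  have "closed {x :: nat \<Rightarrow> complex. x i = c * x j}"
    by (intro closed_Collect_eq continuous_intros continuous_on_product_coordinates)
  moreover have "E = torus \<inter> {x. x i = c * x j}" by (auto simp: E_def)
  ultimately have E: "E \<in> sets \<mu>" using haar_law_sets[OF \<mu>] by simp
  define m where "m k = (\<lambda>l. if l = i then int k else if l = j then - int k else 0)" for k :: nat
  have supp: "{l. m k l \<noteq> 0} \<subseteq> {i, j}" for k by (auto simp: m_def)
  have "prob E = 0"
  proof (rule haar_law_constant_coefficients_zero[OF \<mu> E])
    have "inj m"
    proof (rule injI)
      fix k k' assume "m k = m k'"
      then have "m k i = m k' i" by simp
      then show "k = k'" by (simp add: m_def)
    qed
    then show "infinite (range m)" by (simp add: finite_image_iff)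
    fix n assume "n \<in> range m"
    then obtain k where n: "n = m k" by blast
    show "finite {l. n l \<noteq> 0}" unfolding n using supp[of k] by (rule finite_subset) simp
    have "indicator E x *\<^sub>R monomial n x = indicator E x *\<^sub>R c ^ k" for x
    proof (cases "x \<in> E")
      case True
      then have x: "x i = c * x j" "cmod (x j) = 1" by (auto simp: E_def torus_def)
      then have "x j \<noteq> 0" by (metis norm_zero zero_neq_one)
      have "monomial n x = (\<Prod>l\<in>{i, j}. x l powi n l)"
        by (rule monomial_eq_prod) (use supp n in auto)
      also have "\<dots> = x i powi int k * x j powi (- int k)" using \<open>i \<noteq> j\<close> by (simp add: n m_def)
      also have "\<dots> = c ^ k" using \<open>x j \<noteq> 0\<close> by (simp add: x power_int_minus power_mult_distrib)
      finally show ?thesis by simp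
    qed simp
    then have "(\<integral>x. indicator E x *\<^sub>R monomial n x \<partial>\<mu>) = (\<integral>x. indicator E x *\<^sub>R c ^ k \<partial>\<mu>)"
      by (simp only:)
    also have "\<dots> = prob E *\<^sub>R c ^ k"
      using E by (subst Bochner_Integration.integral_scaleR_left) (auto simp: emeasure_eq_measure)
    finally show "cmod (\<integral>x. indicator E x *\<^sub>R monomial n x \<partial>\<mu>) = prob E"
      using c by (simp add: norm_power)
  qed
  then have "emeasure \<mu> E = 0" by (simp add: emeasure_eq_measure)
  then have "AE x in \<mu>. x \<notin> E" using E by (intro AE_not_in) (simp add: null_sets_def)
  then show ?thesis using haar_law_AE_torus[OF \<mu>] by eventually_elim (auto simp: E_def)
qed

section \<open>Characters of countable abelian groups\<close>

definition character :: "('g, 'r) monoid_scheme \<Rightarrow> ('g \<Rightarrow> complex) \<Rightarrow> bool" where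
  "character H \<theta> \<longleftrightarrow> (\<forall>h\<in>carrier H. norm (\<theta> h) = 1) \<and>
     (\<forall>h\<in>carrier H. \<forall>k\<in>carrier H. \<theta> (h \<otimes>\<^bsub>H\<^esub> k) = \<theta> h * \<theta> k)"

text \<open>Enumerate \<open>H\<close> as \<open>e\<close> and let \<open>R\<close> consist of the multiplicative relations between the \<open>e\<^sub>i\<close>. Almost
  every point of the Haar measure for \<open>R\<close> satisfies these relations, among them the multiplication
  table of \<open>H\<close>, and hence defines a character. If all of them were trivial at \<open>a\<close>, then
  the coordinate belonging to \<open>a\<close> would have mean \<open>1\<close>; but its mean is \<open>0\<close>, as \<open>a\<close> is not the unit.\<close>

lemma characters_separate_points:
  assumes H: "comm_group H" and countable: "countable (carrier H)"
    and a: "a \<in> carrier H" "a \<noteq> \<one>\<^bsub>H\<^esub>"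
  obtains \<theta> where "character H \<theta>" "\<theta> a \<noteq> 1"
proof -
  interpret comm_group H by fact
  have ne: "carrier H \<noteq> {}" by auto
  define e where "e = from_nat_into (carrier H)"
  have e [simp]: "e i \<in> carrier H" for i unfolding e_def by (rule from_nat_into[OF ne])
  have range_e: "range e = carrier H" unfolding e_def by (rule range_from_nat_into[OF ne countable])
  \<comment> \<open>An index at which \<open>h\<close> occurs in the enumeration; \<open>\<delta> h\<close> is the corresponding unit vector.\<close>
  define idx where "idx h = (SOME i. e i = h)" for h
  have idx: "e (idx h) = h" if "h \<in> carrier H" for h
  proof -
    have "h \<in> range e" using that range_e by simp
    then have "\<exists>i. e i = h" by auto
    then show ?thesis unfolding idx_def by (rule someI_ex)
  qed
  define val where "val n = finprod H (\<lambda>i. e i [^]\<^bsub>H\<^esub> (n i :: int)) {i. n i \<noteq> 0}" for n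
  have val_eq: "val n = finprod H (\<lambda>i. e i [^]\<^bsub>H\<^esub> n i) F" if "finite F" "{i. n i \<noteq> 0} \<subseteq> F" for n F
    unfolding val_def using that by (intro finprod_mono_neutral_cong_left) auto
  define R where "R = {n. finite {i. n i \<noteq> 0} \<and> val n = \<one>\<^bsub>H\<^esub>}"
  have val_add: "val (\<lambda>i. n i + m i) = val n \<otimes>\<^bsub>H\<^esub> val m"
    if "finite {i. n i \<noteq> 0}" "finite {i. m i \<noteq> 0}" for n m
  proof -
    define F where "F = {i. n i \<noteq> 0} \<union> {i. m i \<noteq> 0}"
    have F: "finite F" using that by (simp add: F_def)
    have "val (\<lambda>i. n i + m i) = finprod H (\<lambda>i. e i [^]\<^bsub>H\<^esub> (n i + m i)) F"
      by (rule val_eq[OF F]) (auto simp: F_def)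
    also have "\<dots> = finprod H (\<lambda>i. e i [^]\<^bsub>H\<^esub> n i \<otimes>\<^bsub>H\<^esub> e i [^]\<^bsub>H\<^esub> m i) F"
      by (rule finprod_cong') (auto simp: int_pow_mult)
    also have "\<dots> = finprod H (\<lambda>i. e i [^]\<^bsub>H\<^esub> n i) F \<otimes>\<^bsub>H\<^esub> finprod H (\<lambda>i. e i [^]\<^bsub>H\<^esub> m i) F"
      by (rule finprod_multf) auto
    also have "\<dots> = val n \<otimes>\<^bsub>H\<^esub> val m"
      using val_eq[OF F, of n] val_eq[OF F, of m] by (simp add: F_def)
    finally show ?thesis .
  qed
  have val_closed: "val n \<in> carrier H" for n unfolding val_def by (rule finprod_closed) auto
  have fin_diff: "finite {i. n i - m i \<noteq> 0}" if "finite {i. n i \<noteq> 0}" "finite {i. m i \<noteq> 0}" for n m :: "nat \<Rightarrow> int"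
    by (rule finite_subset[OF _ finite_UnI[OF that]]) auto
  have R: "relation_group R"
    unfolding relation_group_def
  proof (intro conjI ballI)
    show "(\<lambda>_. 0) \<in> R" by (simp add: R_def val_def)
    show "finite {i. n i \<noteq> 0}" if "n \<in> R" for n using that by (simp add: R_def)
    fix n m assume nm: "n \<in> R" "m \<in> R"
    have "val n = val (\<lambda>i. (n i - m i) + m i)" by simp
    also have "\<dots> = val (\<lambda>i. n i - m i) \<otimes>\<^bsub>H\<^esub> val m"
      by (rule val_add) (use nm fin_diff in \<open>auto simp: R_def\<close>)
    finally show "(\<lambda>i. n i - m i) \<in> R"
      using nm fin_diff val_closed by (simp add: R_def)
  qed
  define \<delta> where "\<delta> h = (\<lambda>i. if i = idx h then 1 else 0 :: int)" for h
  have \<delta>_fin: "finite {i. \<delta> h i \<noteq> 0}" for h by (simp add: \<delta>_def)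
  have val_\<delta>: "val (\<delta> h) = h" if "h \<in> carrier H" for h
    using that by (subst val_eq[of "{idx h}"]) (auto simp: \<delta>_def idx)
  have mono_\<delta>: "monomial (\<delta> h) x = x (idx h)" for h x
    by (subst monomial_eq_prod[of "{idx h}"]) (auto simp: \<delta>_def)
  obtain \<mu> where \<mu>: "haar_law R \<mu>" using haar_law_exists[OF R] by blast
  interpret P: prob_space \<mu> using \<mu> by (simp add: haar_law_def)
  have char: "character H (\<lambda>h. x (idx h))" if x: "x \<in> torus" "\<forall>n\<in>R. monomial n x = 1" for x
    unfolding character_def
  proof (intro conjI ballI)
    show "norm (x (idx h)) = 1" for h using x by (simp add: torus_def)
    fix h k assume hk: "h \<in> carrier H" "k \<in> carrier H"
    let ?m = "\<lambda>i. \<delta> h i + \<delta> k i" and ?l = "\<delta> (h \<otimes>\<^bsub>H\<^esub> k)"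
    have m: "finite {i. ?m i \<noteq> 0}"
      by (rule finite_subset[OF _ finite_UnI[OF \<delta>_fin[of h] \<delta>_fin[of k]]]) auto
    have "val ?m = val ?l" using hk by (simp add: val_add \<delta>_fin val_\<delta>)
    moreover have "val ?m = val (\<lambda>i. (?m i - ?l i) + ?l i)" by simp
    moreover have "\<dots> = val (\<lambda>i. ?m i - ?l i) \<otimes>\<^bsub>H\<^esub> val ?l"
      by (rule val_add[OF fin_diff[OF m \<delta>_fin] \<delta>_fin])
    ultimately have "val (\<lambda>i. ?m i - ?l i) = \<one>\<^bsub>H\<^esub>"
      using val_closed by (metis r_cancel_one')
    then have "monomial (\<lambda>i. ?m i - ?l i) x = 1"
      using x(2) fin_diff[OF m \<delta>_fin, of "h \<otimes>\<^bsub>H\<^esub> k"] by (simp add: R_def)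
    moreover have "monomial ?m x = monomial (\<lambda>i. ?m i - ?l i) x * monomial ?l x"
      using monomial_add[OF x(1) fin_diff[OF m \<delta>_fin] \<delta>_fin, of "h \<otimes>\<^bsub>H\<^esub> k" "h \<otimes>\<^bsub>H\<^esub> k"] by simp
    moreover have "monomial ?m x = monomial (\<delta> h) x * monomial (\<delta> k) x"
      by (rule monomial_add[OF x(1) \<delta>_fin \<delta>_fin])
    ultimately show "x (idx (h \<otimes>\<^bsub>H\<^esub> k)) = x (idx h) * x (idx k)" by (simp add: mono_\<delta>)
  qed
  have AE: "AE x in \<mu>. x \<in> torus \<and> (\<forall>n\<in>R. monomial n x = 1)"
    using \<mu> haar_law_AE_monomial_eq_1[OF R \<mu>] by (auto simp: haar_law_def)
  have "\<exists>x. x \<in> torus \<and> (\<forall>n\<in>R. monomial n x = 1) \<and> x (idx a) \<noteq> 1"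
  proof (rule ccontr)
    assume *: "\<not> ?thesis"
    have "AE x in \<mu>. monomial (\<delta> a) x = 1"
      using AE by eventually_elim (use * in \<open>auto simp: mono_\<delta>\<close>)
    then have "(\<integral>x. monomial (\<delta> a) x \<partial>\<mu>) = (\<integral>x. 1 \<partial>\<mu>)"
      using \<mu> by (intro integral_cong_AE) (auto simp: haar_law_def cong: measurable_cong_sets)
    then have "(\<integral>x. monomial (\<delta> a) x \<partial>\<mu>) = 1" using P.prob_space by simp
    moreover have "\<delta> a \<notin> R" using a by (simp add: R_def val_\<delta>)
    ultimately show False using \<mu> \<delta>_fin[of a] by (simp add: haar_law_def)
  qed
  then obtain x where x: "x \<in> torus" "\<forall>n\<in>R. monomial n x = 1" "x (idx a) \<noteq> 1" by blast
  show thesis using char[OF x(1,2)] x(3) by (rule that)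
qed

section \<open>Central sequences close to the identity in all characters\<close>

text \<open>The next index is chosen beyond all bounds that belong to indices up to the current one.\<close>

lemma strict_mono_pairwise_subsequence:
  assumes "\<And>m::nat. \<forall>\<^sub>F n in sequentially. P m n"
  obtains r :: "nat \<Rightarrow> nat" where "strict_mono r" "\<And>i j. i < j \<Longrightarrow> P (r i) (r j)"
proof -
  have "\<forall>m. \<exists>N. \<forall>n\<ge>N. P m n" using assms by (simp add: eventually_sequentially)
  then obtain N where N: "\<And>m n. n \<ge> N m \<Longrightarrow> P m n" by metis
  \<comment> \<open>The sum over all indices up to \<open>m\<close>, rather than \<open>N m\<close> alone, makes the bound monotone.\<close>
  define B where "B m = Suc m + (\<Sum>i\<le>m. N i)" for m
  define r where "r = rec_nat 0 (\<lambda>_. B)"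
  have r_Suc: "r (Suc i) = B (r i)" for i by (simp add: r_def)
  have "r i < r (Suc i)" for i by (simp add: r_Suc B_def)
  then have mono: "strict_mono r" by (rule strict_monoI_Suc)
  have "P (r i) (r j)" if "i < j" for i j
  proof (rule N)
    obtain k where k: "j = Suc k" "i \<le> k" using \<open>i < j\<close> by (cases j) auto
    have "r i \<le> r k" using mono k by (simp add: strict_mono_less_eq)
    then have "N (r i) \<le> (\<Sum>i\<le>r k. N i)" by (intro member_le_sum) auto
    then show "N (r i) \<le> r j" by (simp add: k r_Suc B_def)
  qed
  with mono show thesis by (rule that)
qed

text \<open>The bicommutant of a set of commuting elements contains the set and is contained in the commutant,
  all of whose elements commute with it.\<close>

lemma (in group) bicommutant_abelian_subgroup:
  assumes g: "\<And>n::nat. g n \<in> carrier G" and comm: "\<And>m n. g m \<otimes> g n = g n \<otimes> g m"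
  obtains A where "subgroup A G" "\<And>x y. x \<in> A \<Longrightarrow> y \<in> A \<Longrightarrow> x \<otimes> y = y \<otimes> x" "\<And>n. g n \<in> A"
proof -
  define C where "C = {c \<in> carrier G. \<forall>n. c \<otimes> g n = g n \<otimes> c}"
  define A where "A = {x \<in> carrier G. \<forall>c\<in>C. x \<otimes> c = c \<otimes> x}"
  have CG: "c \<in> carrier G" if "c \<in> C" for c using that by (simp add: C_def)
  have gC: "g n \<in> C" for n using g comm by (simp add: C_def)
  have gA: "g n \<in> A" for n using g by (auto simp: A_def C_def)
  have AC: "A \<subseteq> C" using gC by (auto simp: A_def C_def)
  have "subgroup A G"
  proof (rule subgroupI)
    show "A \<subseteq> carrier G" by (auto simp: A_def)
    show "A \<noteq> {}" using gA by auto
    fix x assume x: "x \<in> A"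
    then have xG: "x \<in> carrier G" by (simp add: A_def)
    have "inv x \<otimes> c = c \<otimes> inv x" if c: "c \<in> C" for c
    proof -
      have "x \<otimes> c = c \<otimes> x" using x c by (simp add: A_def)
      then have "inv x \<otimes> (x \<otimes> c) \<otimes> inv x = inv x \<otimes> (c \<otimes> x) \<otimes> inv x" by simp
      moreover have "inv x \<otimes> (x \<otimes> c) \<otimes> inv x = c \<otimes> inv x"
        using xG CG[OF c] by (simp add: m_assoc[symmetric])
      moreover have "inv x \<otimes> (c \<otimes> x) \<otimes> inv x = inv x \<otimes> c"
        using xG CG[OF c] by (simp add: m_assoc)
      ultimately show ?thesis by simp
    qed
    then show "inv x \<in> A" using xG by (simp add: A_def)
    fix y assume y: "y \<in> A"
    then have yG: "y \<in> carrier G" by (simp add: A_def)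
    have "x \<otimes> y \<otimes> c = c \<otimes> (x \<otimes> y)" if c: "c \<in> C" for c
    proof -
      have "x \<otimes> y \<otimes> c = x \<otimes> (y \<otimes> c)" using xG yG CG[OF c] by (rule m_assoc)
      also have "\<dots> = x \<otimes> (c \<otimes> y)" using y c by (simp add: A_def)
      also have "\<dots> = x \<otimes> c \<otimes> y" using xG yG CG[OF c] by (simp add: m_assoc)
      also have "\<dots> = c \<otimes> x \<otimes> y" using x c by (simp add: A_def)
      finally show ?thesis using xG yG CG[OF c] by (simp add: m_assoc)
    qed
    then show "x \<otimes> y \<in> A" using xG yG by (simp add: A_def)
  qed
  moreover have "x \<otimes> y = y \<otimes> x" if "x \<in> A" "y \<in> A" for x y
    using that AC by (auto simp: A_def)
  ultimately show thesis using gA by (rule that)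
qed

lemma separating_characters_exist:
  assumes H: "comm_group H" and countable: "countable (carrier H)"
  obtains \<theta> :: "nat \<Rightarrow> _ \<Rightarrow> complex" where "\<And>j. character H (\<theta> j)"
    "\<And>a. a \<in> carrier H \<Longrightarrow> a \<noteq> \<one>\<^bsub>H\<^esub> \<Longrightarrow> \<exists>j. \<theta> j a \<noteq> 1"
proof -
  interpret comm_group H by fact
  have ne: "carrier H \<noteq> {}" by auto
  have "\<exists>\<theta>. character H \<theta> \<and> (a \<in> carrier H \<and> a \<noteq> \<one>\<^bsub>H\<^esub> \<longrightarrow> \<theta> a \<noteq> 1)" for a
  proof (cases "a \<in> carrier H \<and> a \<noteq> \<one>\<^bsub>H\<^esub>")
    case True
    then show ?thesis using characters_separate_points[OF H countable, of a] by metis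
  next
    case False
    have "character H (\<lambda>_. 1)" by (simp add: character_def)
    with False show ?thesis by blast
  qed
  then obtain \<Theta> where \<Theta>: "\<And>a. character H (\<Theta> a)"
    "\<And>a. a \<in> carrier H \<Longrightarrow> a \<noteq> \<one>\<^bsub>H\<^esub> \<Longrightarrow> \<Theta> a a \<noteq> 1" by metis
  show thesis
  proof (rule that[of "\<lambda>j. \<Theta> (from_nat_into (carrier H) j)"])
    fix a assume a: "a \<in> carrier H" "a \<noteq> \<one>\<^bsub>H\<^esub>"
    then obtain j where "from_nat_into (carrier H) j = a"
      using from_nat_into_surj[OF countable] by blast
    then show "\<exists>j. \<Theta> (from_nat_into (carrier H) j) a \<noteq> 1" using \<Theta>(2)[OF a] by auto
  qed (rule \<Theta>(1))
qed

lemma tendsto_coordinate: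
  fixes x :: "nat \<Rightarrow> 'i \<Rightarrow> 'b::topological_space"
  shows "x \<longlonglongrightarrow> l \<longleftrightarrow> (\<forall>i. (\<lambda>n. x n i) \<longlonglongrightarrow> l i)"
proof -
  have "x \<longlonglongrightarrow> l \<longleftrightarrow> limitin (product_topology (\<lambda>_. euclidean) UNIV) x l sequentially"
    by (simp add: euclidean_product_topology limitin_canonical_iff)
  also have "\<dots> \<longleftrightarrow> (\<forall>i. (\<lambda>n. x n i) \<longlonglongrightarrow> l i)"
    by (simp add: limitin_componentwise limitin_canonical_iff)
  finally show ?thesis .
qed

text \<open>The \<open>a\<^sub>n\<close> are quotients of consecutive terms of a subsequence of \<open>g\<close> along which every \<open>\<theta>\<^sub>j\<close>
  converges; the limits have modulus \<open>1\<close>, so the quotients of the values tend to \<open>1\<close>. Divergence of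
  \<open>g\<close> makes the terms distinct, which keeps the \<open>a\<^sub>n\<close> away from the unit.\<close>

lemma (in group) central_sequence_with_characters:
  assumes countable: "countable (carrier G)" and central: "central_sequence G g"
    and div: "diverges_to_infinity G g"
  obtains A \<theta> a where "subgroup A G" "\<And>x y. x \<in> A \<Longrightarrow> y \<in> A \<Longrightarrow> x \<otimes> y = y \<otimes> x"
    "\<And>j::nat. character (G\<lparr>carrier := A\<rparr>) (\<theta> j)"
    "\<And>x. x \<in> A \<Longrightarrow> x \<noteq> \<one> \<Longrightarrow> \<exists>j. \<theta> j x \<noteq> 1"
    "central_sequence G a" "\<And>n. a n \<in> A" "\<And>n. a n \<noteq> \<one>" "\<And>j. (\<lambda>n. \<theta> j (a n)) \<longlonglongrightarrow> 1"
proof -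
  have g: "g n \<in> carrier G" for n using central by (simp add: central_sequence_def)
  have ev: "\<forall>\<^sub>F n in sequentially. g m \<noteq> g n \<and> g m \<otimes> g n = g n \<otimes> g m" for m
  proof -
    have "\<forall>\<^sub>F n in sequentially. g n \<notin> {g m}"
      using div g[of m] unfolding diverges_to_infinity_def by blast
    moreover have "\<forall>\<^sub>F n in sequentially. g n \<otimes> g m = g m \<otimes> g n"
      using central g[of m] by (simp add: central_sequence_def)
    ultimately show ?thesis by eventually_elim auto
  qed
  have "\<exists>r::nat \<Rightarrow> nat. strict_mono r \<and>
      (\<forall>i j. i < j \<longrightarrow> g (r i) \<noteq> g (r j) \<and> g (r i) \<otimes> g (r j) = g (r j) \<otimes> g (r i))"
    by (rule strict_mono_pairwise_subsequence[of "\<lambda>m n. g m \<noteq> g n \<and> g m \<otimes> g n = g n \<otimes> g m", OF ev])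
      blast
  then obtain r :: "nat \<Rightarrow> nat" where r: "strict_mono r"
      and gr: "i < j \<Longrightarrow> g (r i) \<noteq> g (r j) \<and> g (r i) \<otimes> g (r j) = g (r j) \<otimes> g (r i)" for i j
    by auto
  have comm: "g (r m) \<otimes> g (r n) = g (r n) \<otimes> g (r m)" for m n
    using gr[of m n] gr[of n m] by (cases m n rule: linorder_cases) simp_all
  have "\<exists>A. subgroup A G \<and> (\<forall>x\<in>A. \<forall>y\<in>A. x \<otimes> y = y \<otimes> x) \<and> (\<forall>n. g (r n) \<in> A)"
    by (rule bicommutant_abelian_subgroup[of "\<lambda>n. g (r n)", OF g comm]) blast
  then obtain A where A: "subgroup A G" "\<And>x y. x \<in> A \<Longrightarrow> y \<in> A \<Longrightarrow> x \<otimes> y = y \<otimes> x" "\<And>n. g (r n) \<in> A"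
    by auto
  interpret A: subgroup A G by fact
  let ?H = "G\<lparr>carrier := A\<rparr>"
  have H: "comm_group ?H"
    using A(2) by (intro group.group_comm_groupI A.subgroup_is_group is_group) simp
  have "countable (carrier ?H)" using countable A.subset countable_subset by auto
  then have "\<exists>\<theta>. (\<forall>j::nat. character ?H (\<theta> j)) \<and> (\<forall>x\<in>carrier ?H. x \<noteq> \<one>\<^bsub>?H\<^esub> \<longrightarrow> (\<exists>j. \<theta> j x \<noteq> 1))"
    by (rule separating_characters_exist[OF H]) blast
  then obtain \<theta> where \<theta>: "\<And>j::nat. character ?H (\<theta> j)" "\<And>x. x \<in> A \<Longrightarrow> x \<noteq> \<one> \<Longrightarrow> \<exists>j. \<theta> j x \<noteq> 1"
    by auto
  have \<theta>_norm: "norm (\<theta> j x) = 1" if "x \<in> A" for j x using \<theta>(1)[of j] that by (simp add: character_def)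
  have \<theta>_mult: "\<theta> j (x \<otimes> y) = \<theta> j x * \<theta> j y" if "x \<in> A" "y \<in> A" for j x y
    using \<theta>(1)[of j] that by (simp add: character_def)
  define b where "b k j = \<theta> j (g (r k))" for k j
  have "seq_compact torus" by (rule compact_imp_seq_compact[OF compact_torus])
  moreover have "\<forall>k. b k \<in> torus" using A(3) \<theta>_norm by (simp add: b_def torus_def)
  ultimately obtain l q where l: "l \<in> torus" and q: "strict_mono q" and lim: "(b \<circ> q) \<longlonglongrightarrow> l"
    by (metis seq_compactE)
  have lim_j: "(\<lambda>k. \<theta> j (g (r (q k)))) \<longlonglongrightarrow> l j" for j
    using lim unfolding tendsto_coordinate by (simp add: b_def comp_def)
  define a where "a k = inv g (r (q (Suc k))) \<otimes> g (r (q k))" for k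
  have aA: "a k \<in> A" for k by (simp add: a_def A)
  have ga: "g (r (q (Suc k))) \<otimes> a k = g (r (q k))" for k
    using g by (simp add: a_def m_assoc[symmetric])
  show thesis
  proof (rule that[OF A(1,2) \<theta>(1,2)])
    show "a n \<in> A" for n by (rule aA)
    show "a n \<noteq> \<one>" for n
    proof
      assume "a n = \<one>"
      then have "g (r (q (Suc n))) = g (r (q n))" using ga[of n] g by simp
      moreover have "q n < q (Suc n)" using q by (simp add: strict_mono_Suc_iff)
      ultimately show False using gr by metis
    qed
    show "(\<lambda>n. \<theta> j (a n)) \<longlonglongrightarrow> 1" for j
    proof -
      have lj: "l j \<noteq> 0" using l by (auto simp: torus_def) (metis norm_zero zero_neq_one)
      have "\<theta> j (a n) = \<theta> j (g (r (q n))) / \<theta> j (g (r (q (Suc n))))" for n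
      proof -
        have "\<theta> j (g (r (q (Suc n)))) * \<theta> j (a n) = \<theta> j (g (r (q n)))"
          using \<theta>_mult[OF A(3) aA] ga by metis
        moreover have "\<theta> j (g (r (q (Suc n)))) \<noteq> 0" using \<theta>_norm[OF A(3)] by (metis norm_zero zero_neq_one)
        ultimately show ?thesis by (simp add: field_simps)
      qed
      moreover have "(\<lambda>n. \<theta> j (g (r (q n))) / \<theta> j (g (r (q (Suc n))))) \<longlonglongrightarrow> l j / l j"
        using lj by (intro tendsto_divide lim_j LIMSEQ_Suc[OF lim_j])
      ultimately show ?thesis using lj by simp
    qed
    show "central_sequence G a"
      unfolding central_sequence_def
    proof (intro conjI allI ballI)
      show "a n \<in> carrier G" for n using aA A.subset by auto
      fix h assume h: "h \<in> carrier G"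
      have "strict_mono (\<lambda>n. r (q n))" using r q by (simp add: strict_mono_def)
      moreover have "\<forall>\<^sub>F n in sequentially. g n \<otimes> h = h \<otimes> g n"
        using central h by (simp add: central_sequence_def)
      ultimately have "\<forall>\<^sub>F n in sequentially. g (r (q n)) \<otimes> h = h \<otimes> g (r (q n))"
        by (rule eventually_subseq[where P = "\<lambda>n. g n \<otimes> h = h \<otimes> g n"])
      moreover from this have "\<forall>\<^sub>F n in sequentially. g (r (q (Suc n))) \<otimes> h = h \<otimes> g (r (q (Suc n)))"
        by (rule eventually_sequentially_Suc[of "\<lambda>n. g (r (q n)) \<otimes> h = h \<otimes> g (r (q n))", THEN iffD2])
      ultimately show "\<forall>\<^sub>F n in sequentially. a n \<otimes> h = h \<otimes> a n"
      proof eventually_elim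
        case (elim n)
        let ?u = "g (r (q n))" and ?v = "g (r (q (Suc n)))"
        have "inv ?v \<otimes> h = inv ?v \<otimes> (h \<otimes> ?v) \<otimes> inv ?v" using g h by (simp add: m_assoc)
        also have "\<dots> = inv ?v \<otimes> (?v \<otimes> h) \<otimes> inv ?v" using elim(2) by simp
        also have "\<dots> = h \<otimes> inv ?v" using g h by (simp add: m_assoc[symmetric])
        finally have v: "inv ?v \<otimes> h = h \<otimes> inv ?v" .
        have "a n \<otimes> h = inv ?v \<otimes> (?u \<otimes> h)" using g h by (simp add: a_def m_assoc)
        also have "\<dots> = inv ?v \<otimes> (h \<otimes> ?u)" using elim(1) by simp
        also have "\<dots> = inv ?v \<otimes> h \<otimes> ?u" using g h by (simp add: m_assoc)
        also have "\<dots> = h \<otimes> a n" unfolding v using g h by (simp add: a_def m_assoc)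
        finally show ?case .
      qed
    qed
  qed
qed

section \<open>The cocycle of a coset space\<close>

text \<open>The elements \<open>s p\<close>, \<open>p \<in> P\<close>, represent the left cosets of \<open>A\<close>. Left multiplication by \<open>g\<close> maps
  the coset of \<open>s p\<close> to that of \<open>s (perm g p)\<close>, and \<open>g \<otimes> s p = s (perm g p) \<otimes> cocycle g p\<close>. Both
  functions are made trivial outside \<open>P\<close>, so that \<open>perm\<close> acts on all natural numbers.\<close>

locale coset_cocycle = group G + A: subgroup A G for G (structure) and A +
  fixes P :: "nat set" and s :: "nat \<Rightarrow> 'a"
  assumes s_closed: "p \<in> P \<Longrightarrow> s p \<in> carrier G"
    and s_unique: "x \<in> carrier G \<Longrightarrow> \<exists>!p. p \<in> P \<and> inv s p \<otimes> x \<in> A"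
begin

definition perm :: "'a \<Rightarrow> nat \<Rightarrow> nat" where
  "perm g p = (if p \<in> P then THE q. q \<in> P \<and> inv s q \<otimes> (g \<otimes> s p) \<in> A else p)"

definition cocycle :: "'a \<Rightarrow> nat \<Rightarrow> 'a" where
  "cocycle g p = (if p \<in> P then inv s (perm g p) \<otimes> (g \<otimes> s p) else \<one>)"

lemma perm_outside [simp]: "p \<notin> P \<Longrightarrow> perm g p = p"
  and cocycle_outside [simp]: "p \<notin> P \<Longrightarrow> cocycle g p = \<one>"
  by (simp_all add: perm_def cocycle_def)

lemma perm_cocycle:
  assumes "g \<in> carrier G" "p \<in> P"
  shows perm_closed: "perm g p \<in> P" and cocycle_closed: "cocycle g p \<in> A"
    and perm_cocycle_eq: "s (perm g p) \<otimes> cocycle g p = g \<otimes> s p"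
proof -
  have x: "g \<otimes> s p \<in> carrier G" using assms s_closed by simp
  from theI'[OF s_unique[OF x]] show 1: "perm g p \<in> P" and "cocycle g p \<in> A"
    using assms by (simp_all add: perm_def cocycle_def)
  show "s (perm g p) \<otimes> cocycle g p = g \<otimes> s p"
    using assms x s_closed[OF 1] by (simp add: cocycle_def m_assoc[symmetric])
qed

lemma perm_cocycle_eqI:
  assumes "g \<in> carrier G" "p \<in> P" "q \<in> P" "a \<in> A" "g \<otimes> s p = s q \<otimes> a"
  shows "perm g p = q" "cocycle g p = a"
proof -
  have aG: "a \<in> carrier G" using assms A.subset by auto
  have q: "inv s q \<otimes> (g \<otimes> s p) = a"
    using assms aG s_closed by (simp add: m_assoc[symmetric])
  have "g \<otimes> s p \<in> carrier G" using assms s_closed by simp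
  from s_unique[OF this] show "perm g p = q"
    using assms q unfolding perm_def by (auto intro!: the1_equality)
  then show "cocycle g p = a" using assms q by (simp add: cocycle_def)
qed

lemma perm_one: "perm \<one> p = p" and cocycle_one: "cocycle \<one> p = \<one>"
  using perm_cocycle_eqI[of \<one> p p \<one>] s_closed by (cases "p \<in> P"; simp)+

lemma perm_cocycle_mult:
  assumes g: "g \<in> carrier G" and h: "h \<in> carrier G"
  shows perm_mult: "perm (g \<otimes> h) p = perm g (perm h p)"
    and cocycle_mult: "cocycle (g \<otimes> h) p = cocycle g (perm h p) \<otimes> cocycle h p"
proof -
  have "perm (g \<otimes> h) p = perm g (perm h p) \<and> cocycle (g \<otimes> h) p = cocycle g (perm h p) \<otimes> cocycle h p"
  proof (cases "p \<in> P")
    case p: True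
    note q = perm_closed[OF h p]
    have c: "cocycle h p \<in> carrier G" "cocycle g (perm h p) \<in> carrier G"
      using cocycle_closed[OF h p] cocycle_closed[OF g q] A.subset by auto
    have "g \<otimes> h \<otimes> s p = g \<otimes> (s (perm h p) \<otimes> cocycle h p)"
      using g h p s_closed perm_cocycle_eq[OF h p] by (simp add: m_assoc)
    also have "\<dots> = s (perm g (perm h p)) \<otimes> cocycle g (perm h p) \<otimes> cocycle h p"
      using g q c s_closed perm_cocycle_eq[OF g q] by (simp add: m_assoc)
    finally have "g \<otimes> h \<otimes> s p = s (perm g (perm h p)) \<otimes> (cocycle g (perm h p) \<otimes> cocycle h p)"
      using c s_closed[OF perm_closed[OF g q]] by (simp add: m_assoc)
    then show ?thesis
      using perm_cocycle_eqI g h p perm_closed[OF g q] cocycle_closed[OF g q] cocycle_closed[OF h p]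
      by (meson A.m_closed m_closed)
  qed simp
  then show "perm (g \<otimes> h) p = perm g (perm h p)"
    and "cocycle (g \<otimes> h) p = cocycle g (perm h p) \<otimes> cocycle h p" by auto
qed

lemma perm_inv: "g \<in> carrier G \<Longrightarrow> perm (inv g) (perm g p) = p"
  "g \<in> carrier G \<Longrightarrow> perm g (perm (inv g) p) = p"
  by (simp_all add: perm_mult[symmetric] perm_one)

lemma perm_transitive:
  assumes "p \<in> P" "q \<in> P"
  obtains g where "g \<in> carrier G" "perm g p = q"
proof (rule that)
  show "s q \<otimes> inv s p \<in> carrier G" using assms s_closed by simp
  then show "perm (s q \<otimes> inv s p) p = q"
    by (rule perm_cocycle_eqI[where a = \<one>]) (use assms s_closed in \<open>simp_all add: m_assoc\<close>)
qed

text \<open>The stabiliser of a coset acts on the fibre over it through all of \<open>A\<close>.\<close>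

lemma cocycle_surj_stabilizer:
  assumes "p \<in> P" "a \<in> A"
  obtains g where "g \<in> carrier G" "perm g p = p" "cocycle g p = a"
proof -
  have aG: "a \<in> carrier G" using assms A.subset by auto
  have g: "s p \<otimes> a \<otimes> inv s p \<in> carrier G" using assms s_closed aG by simp
  moreover have "s p \<otimes> a \<otimes> inv s p \<otimes> s p = s p \<otimes> a" using assms s_closed aG by (simp add: m_assoc)
  ultimately show thesis using perm_cocycle_eqI[OF g assms(1,1,2)] that by metis
qed

lemma perm_cocycle_commuting:
  assumes "p \<in> P" "a \<in> A" "a \<otimes> s p = s p \<otimes> a"
  shows "perm a p = p" "cocycle a p = a"
  using perm_cocycle_eqI[of a p p a] assms A.subset by auto

lemma cocycle_nontrivial:
  assumes "g \<in> carrier G" "g \<noteq> \<one>" "p \<in> P" "perm g p = p"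
  shows "cocycle g p \<noteq> \<one>"
proof
  assume "cocycle g p = \<one>"
  then have "g \<otimes> s p = \<one> \<otimes> s p" using perm_cocycle_eq[OF assms(1,3)] assms s_closed by simp
  then show False using assms s_closed using assms by simp
qed

end

lemma (in group) coset_enumeration:
  assumes countable: "countable (carrier G)" and A: "subgroup A G"
  obtains P s where "coset_cocycle G A P s" "P = UNIV \<or> (\<exists>d>0. P = {..<d})"
proof -
  interpret A: subgroup A G by fact
  define cl where "cl x = {y \<in> carrier G. inv x \<otimes> y \<in> A}" for x
  have cl_eq: "inv x \<otimes> y \<in> A \<longleftrightarrow> cl x = cl y" if x: "x \<in> carrier G" and y: "y \<in> carrier G" for x y
  proof
    assume xy: "inv x \<otimes> y \<in> A"
    have *: "inv x \<otimes> z \<in> A" if "inv y \<otimes> z \<in> A" "z \<in> carrier G" for z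
    proof -
      have "inv x \<otimes> z = (inv x \<otimes> y) \<otimes> (inv y \<otimes> z)"
        using x y that by (simp add: m_assoc) (simp add: m_assoc[symmetric])
      then show ?thesis using xy that by simp
    qed
    have "inv y \<otimes> z \<in> A" if "inv x \<otimes> z \<in> A" "z \<in> carrier G" for z
    proof -
      have "inv y \<otimes> z = inv (inv x \<otimes> y) \<otimes> (inv x \<otimes> z)"
        using x y that by (simp add: inv_mult_group m_assoc) (simp add: m_assoc[symmetric])
      then show ?thesis using xy that by simp
    qed
    with * show "cl x = cl y" by (auto simp: cl_def)
  next
    assume "cl x = cl y"
    moreover have "y \<in> cl y" using y by (simp add: cl_def)
    ultimately show "inv x \<otimes> y \<in> A" by (auto simp: cl_def)
  qed
  let ?K = "cl ` carrier G"
  have K: "countable ?K" using countable by simp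
  have "\<exists>P e. bij_betw e P ?K \<and> (P = UNIV \<or> (\<exists>d>0. P = {..<d::nat}))"
  proof (cases "finite ?K")
    case True
    then obtain e where e: "bij_betw e {0..<card ?K} ?K" using ex_bij_betw_nat_finite by blast
    moreover have "card ?K > 0" using True by (simp add: card_gt_0_iff) auto
    ultimately have "bij_betw e {..<card ?K} ?K \<and> card ?K > 0" by (simp add: atLeast0LessThan)
    then show ?thesis by (intro exI[of _ "{..<card ?K}"] exI[of _ e] conjI disjI2) auto
  next
    case False
    show ?thesis
      by (intro exI[of _ UNIV] exI conjI disjI1 refl) (rule bij_betw_from_nat_into[OF K False])
  qed
  then obtain P e where e: "bij_betw e P ?K" and P: "P = UNIV \<or> (\<exists>d>0. P = {..<d::nat})" by blast
  have "\<exists>x. x \<in> carrier G \<and> cl x = e p" if "p \<in> P" for p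
  proof -
    have "e p \<in> ?K" using e that by (auto simp: bij_betw_def)
    then show ?thesis by auto
  qed
  then obtain s where s: "\<And>p. p \<in> P \<Longrightarrow> s p \<in> carrier G" "\<And>p. p \<in> P \<Longrightarrow> cl (s p) = e p" by metis
  have "coset_cocycle G A P s"
  proof
    fix x assume x: "x \<in> carrier G"
    have "inv s p \<otimes> x \<in> A \<longleftrightarrow> e p = cl x" if "p \<in> P" for p
      using cl_eq[OF s(1)[OF that] x] s(2)[OF that] by simp
    moreover have "\<exists>!p. p \<in> P \<and> e p = cl x"
    proof -
      have "cl x \<in> e ` P" using e x by (simp add: bij_betw_def)
      then show ?thesis using bij_betw_imp_inj_on[OF e] by (auto dest: inj_onD)
    qed
    ultimately show "\<exists>!p. p \<in> P \<and> inv s p \<otimes> x \<in> A" by (metis (no_types, lifting))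
  qed (rule s)
  then show thesis using P by (rule that)
qed

section \<open>The Schmidt property from a central sequence acting almost trivially\<close>

lemma measure_preserving_map_measure_vimage:
  assumes "measure_preserving_map M f" "E \<in> sets M"
  shows "measure M {x \<in> space M. f x \<in> E} = measure M E"
proof -
  have "measure M E = measure (distr M M f) E" using assms by (simp add: measure_preserving_map_def)
  also have "\<dots> = measure M (f -` E \<inter> space M)"
    using assms by (intro measure_distr) (auto simp: measure_preserving_map_def)
  also have "f -` E \<inter> space M = {x \<in> space M. f x \<in> E}" by auto
  finally show ?thesis by simp
qed

text \<open>The sets \<open>E\<close> from which little mass escapes form a \<open>\<sigma>\<close>-algebra: as \<open>f n\<close> preserves the measure,
  equally much mass leaves \<open>E\<close> and its complement, and a countable union is a
  finite one up to small measure.\<close>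

lemma (in prob_space) measure_escape_tendsto_0:
  fixes f :: "nat \<Rightarrow> 'a \<Rightarrow> 'a"
  assumes mp: "\<And>n. measure_preserving_map M (f n)"
    and gen: "sets M = sigma_sets (space M) \<U>" "\<U> \<subseteq> Pow (space M)"
    and basic: "\<And>U. U \<in> \<U> \<Longrightarrow> (\<lambda>n. prob {x \<in> U. f n x \<notin> U}) \<longlonglongrightarrow> 0"
    and "E \<in> sets M"
  shows "(\<lambda>n. prob {x \<in> E. f n x \<notin> E}) \<longlonglongrightarrow> 0"
  using assms(5) unfolding gen(1)
proof induction
  case (Basic U) then show ?case by (rule basic)
next
  case Empty then show ?case by simp
next
  have [measurable]: "f n \<in> measurable M M" for n using mp by (simp add: measure_preserving_map_def)
  case (Compl E)
  have E [measurable]: "E \<in> sets M" using Compl gen by simp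
  have "prob {x \<in> space M - E. f n x \<notin> space M - E} = prob {x \<in> E. f n x \<notin> E}" for n
  proof -
    let ?F = "{x \<in> space M. f n x \<in> E}"
    have "{x \<in> space M - E. f n x \<notin> space M - E} = ?F - E \<inter> ?F"
      using measurable_space[OF \<open>f n \<in> measurable M M\<close>] by auto
    moreover have "{x \<in> E. f n x \<notin> E} = E - E \<inter> ?F"
      using sets.sets_into_space[OF E] by auto
    moreover have "prob ?F = prob E" by (rule measure_preserving_map_measure_vimage[OF mp E])
    ultimately show ?thesis by (simp add: finite_measure_Diff)
  qed
  then show ?case using Compl by simp
next
  have [measurable]: "f n \<in> measurable M M" for n using mp by (simp add: measure_preserving_map_def)
  case (Union A)
  have A [measurable]: "A i \<in> sets M" for i using Union gen by simp
  let ?B = "\<Union>i. A i"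
  show ?case
  proof (rule LIMSEQ_I)
    fix e :: real assume "e > 0"
    have "(\<lambda>N. prob (\<Union>i<N. A i)) \<longlonglongrightarrow> prob (\<Union>N. \<Union>i<N. A i)"
      by (rule finite_Lim_measure_incseq) (auto simp: incseq_def, meson order_less_le_trans lessThan_iff UN_I)
    moreover have "(\<Union>N. \<Union>i<N. A i) = ?B" by auto
    ultimately have "\<forall>\<^sub>F N in sequentially. prob ?B - e / 2 < prob (\<Union>i<N. A i)"
      using \<open>e > 0\<close> by (intro order_tendstoD) auto
    then obtain N where N: "prob ?B - e / 2 < prob (\<Union>i<N. A i)"
      by (auto simp: eventually_sequentially)
    have "prob (?B - (\<Union>i<N. A i)) = prob ?B - prob (\<Union>i<N. A i)"
      by (rule finite_measure_Diff) auto
    then have tail: "prob (?B - (\<Union>i<N. A i)) < e / 2" using N by simp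
    have "(\<lambda>n. \<Sum>i<N. prob {x \<in> A i. f n x \<notin> A i}) \<longlonglongrightarrow> (\<Sum>i<N. 0)"
      by (intro tendsto_sum Union)
    then have "\<forall>\<^sub>F n in sequentially. (\<Sum>i<N. prob {x \<in> A i. f n x \<notin> A i}) < e / 2"
      using \<open>e > 0\<close> by (intro order_tendstoD) auto
    then obtain n0 where n0: "\<And>n. n \<ge> n0 \<Longrightarrow> (\<Sum>i<N. prob {x \<in> A i. f n x \<notin> A i}) < e / 2"
      by (auto simp: eventually_sequentially)
    have meas: "{x \<in> A i. f n x \<notin> A i} \<in> sets M" for i n
    proof -
      have "{x \<in> A i. f n x \<notin> A i} = A i - {x \<in> space M. f n x \<in> A i}"
        using sets.sets_into_space[OF A] by auto
      then show ?thesis by simp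
    qed
    have "prob {x \<in> ?B. f n x \<notin> ?B} < e" if "n \<ge> n0" for n
    proof -
      have "prob {x \<in> ?B. f n x \<notin> ?B} \<le> prob ((\<Union>i<N. {x \<in> A i. f n x \<notin> A i}) \<union> (?B - (\<Union>i<N. A i)))"
        using meas by (intro finite_measure_mono) auto
      also have "\<dots> \<le> prob (\<Union>i<N. {x \<in> A i. f n x \<notin> A i}) + prob (?B - (\<Union>i<N. A i))"
        using meas by (intro measure_Un_le) auto
      also have "prob (\<Union>i<N. {x \<in> A i. f n x \<notin> A i}) \<le> (\<Sum>i<N. prob {x \<in> A i. f n x \<notin> A i})"
        using meas by (intro measure_UNION_le) auto
      finally show ?thesis using n0[OF that] tail by linarith
    qed
    then show "\<exists>no. \<forall>n\<ge>no. norm (prob {x \<in> ?B. f n x \<notin> ?B} - 0) < e" by auto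
  qed
qed

text \<open>If \<open>x\<close> is in the open set \<open>U\<close>, then eventually so is \<open>f n x\<close>.\<close>

lemma measure_escape_tendsto_0_if_pointwise:
  fixes M :: "'x :: topological_space measure" and f :: "nat \<Rightarrow> 'x \<Rightarrow> 'x"
  assumes M: "prob_space M" and borel: "sets M = sets borel"
    and mp: "\<And>n. measure_preserving_map M (f n)"
    and lim: "AE x in M. (\<lambda>n. f n x) \<longlonglongrightarrow> x"
    and E: "E \<in> sets M"
  shows "(\<lambda>n. measure M {x \<in> E. f n x \<notin> E}) \<longlonglongrightarrow> 0"
proof (rule prob_space.measure_escape_tendsto_0[OF M mp _ _ _ E])
  interpret prob_space M by fact
  have sp: "space M = UNIV" using sets_eq_imp_space_eq[OF borel] by simp
  show "sets M = sigma_sets (space M) {U. open U}" by (simp add: sp borel sets_borel)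
  show "{U. open U} \<subseteq> Pow (space M)" by (simp add: sp)
  have [measurable]: "f n \<in> measurable M M" for n using mp by (simp add: measure_preserving_map_def)
  fix U :: "'x set" assume "U \<in> {U. open U}"
  then have U: "open U" and [measurable]: "U \<in> sets M" by (auto simp: borel)
  have eq: "{x \<in> U. f n x \<notin> U} = U - {x \<in> space M. f n x \<in> U}" for n by (auto simp: sp)
  have meas: "{x \<in> U. f n x \<notin> U} \<in> sets M" for n unfolding eq by simp
  have "(\<lambda>n. \<integral>x. indicator {x \<in> U. f n x \<notin> U} x \<partial>M) \<longlonglongrightarrow> (\<integral>x. (0::real) \<partial>M)"
  proof (rule integral_dominated_convergence[where w = "\<lambda>_. 1"])
    show "AE x in M. (\<lambda>n. indicator {x \<in> U. f n x \<notin> U} x :: real) \<longlonglongrightarrow> 0"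
      using lim
    proof eventually_elim
      case (elim x)
      show ?case
      proof (cases "x \<in> U")
        case True
        from topological_tendstoD[OF elim U this]
        show ?thesis by (intro tendsto_eventually) (auto elim: eventually_mono)
      qed simp
    qed
  qed (use meas in auto)
  then show "(\<lambda>n. prob {x \<in> U. f n x \<notin> U}) \<longlonglongrightarrow> 0" using meas by simp
qed

lemma constant_in_full_group:
  assumes act: "pmp_action G M \<phi>" and a: "a \<in> carrier G"
  shows "(\<lambda>_. a) \<in> full_group G M \<phi>"
proof -
  interpret group_action G "space M" \<phi> using act by (simp add: pmp_action_def)
  interpret group G using group_hom group_hom.axioms(1) by auto
  have "\<phi> (inv\<^bsub>G\<^esub> a) (\<phi> a x) = x" "\<phi> a (\<phi> (inv\<^bsub>G\<^esub> a) x) = x" if "x \<in> space M" for x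
    using that a orbit_sym_aux[of a x] orbit_sym_aux[of "inv\<^bsub>G\<^esub> a" x] by auto
  then have "automorphism_mod_null M (\<phi> a)"
    using act a unfolding automorphism_mod_null_def pmp_action_def
    by (intro conjI exI[of _ "\<phi> (inv\<^bsub>G\<^esub> a)"]) auto
  moreover have "induced_map \<phi> (\<lambda>_. a) = \<phi> a" by (auto simp: induced_map_def)
  ultimately show ?thesis using a by (simp add: full_group_def)
qed

text \<open>The sections \<open>a\<^sub>n\<close> and \<open>S\<close> commute at \<open>x\<close> if \<open>a\<^sub>n\<close> commutes with \<open>S x\<close> and \<open>a\<^sub>n\<close> does not move \<open>x\<close> out
  of its fibre of \<open>S\<close>. Up to small measure there are only finitely many fibres, and
  little mass escapes from each of them.\<close>

lemma full_group_central_sequence_constant: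
  assumes G: "group G" "countable (carrier G)" and act: "pmp_action G M \<phi>"
    and central: "central_sequence G a"
    and rigid: "\<And>E. E \<in> sets M \<Longrightarrow> (\<lambda>n. measure M {x \<in> E. \<phi> (a n) x \<notin> E}) \<longlonglongrightarrow> 0"
  shows "full_group_central_sequence G M \<phi> (\<lambda>n _. a n)"
  unfolding full_group_central_sequence_def
proof (intro conjI allI ballI)
  interpret prob_space M using act by (simp add: pmp_action_def standard_prob_space_def)
  interpret group G by fact
  have a: "a n \<in> carrier G" for n using central by (simp add: central_sequence_def)
  show "(\<lambda>_. a n) \<in> full_group G M \<phi>" for n by (rule constant_in_full_group[OF act a])
  fix S assume "S \<in> full_group G M \<phi>"
  then have S [measurable]: "S \<in> measurable M (count_space (carrier G))" by (simp add: full_group_def)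
  have [measurable]: "\<phi> (a n) \<in> measurable M M" for n
    using act a by (simp add: pmp_action_def measure_preserving_map_def)
  define bad where "bad n = {x \<in> space M. a n \<otimes>\<^bsub>G\<^esub> S x \<noteq> S (\<phi> (a n) x) \<otimes>\<^bsub>G\<^esub> a n}" for n
  define fib where "fib h = {x \<in> space M. S x = h}" for h
  have fib [measurable]: "fib h \<in> sets M" if "h \<in> carrier G" for h
    unfolding fib_def using that by simp
  have ne: "carrier G \<noteq> {}" by auto
  define e where "e = from_nat_into (carrier G)"
  have e: "e i \<in> carrier G" for i unfolding e_def by (rule from_nat_into[OF ne])
  have range_e: "range e = carrier G" unfolding e_def by (rule range_from_nat_into[OF ne G(2)])
  have "(\<lambda>n. prob (bad n)) \<longlonglongrightarrow> 0"
  proof (rule LIMSEQ_I)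
    fix r :: real assume "r > 0"
    have "(\<lambda>N. prob (\<Union>i<N. fib (e i))) \<longlonglongrightarrow> prob (\<Union>N. \<Union>i<N. fib (e i))"
      using fib[OF e] by (intro finite_Lim_measure_incseq) (force simp: incseq_def)+
    moreover have "(\<Union>N. \<Union>i<N. fib (e i)) = space M"
    proof -
      have "\<exists>i. x \<in> fib (e i)" if "x \<in> space M" for x
        using measurable_space[OF S that] that range_e by (auto simp: fib_def)
      then show ?thesis by (force simp: fib_def)
    qed
    ultimately have "(\<lambda>N. prob (\<Union>i<N. fib (e i))) \<longlonglongrightarrow> 1" by (simp add: prob_space)
    then have "\<forall>\<^sub>F N in sequentially. 1 - r / 2 < prob (\<Union>i<N. fib (e i))"
      using \<open>r > 0\<close> by (intro order_tendstoD) auto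
    then obtain N where N: "1 - r / 2 < prob (\<Union>i<N. fib (e i))"
      by (auto simp: eventually_sequentially)
    have tail: "prob (space M - (\<Union>i<N. fib (e i))) < r / 2"
      using N fib[OF e] by (subst prob_compl) auto
    have "(\<lambda>n. \<Sum>i<N. prob {x \<in> fib (e i). \<phi> (a n) x \<notin> fib (e i)}) \<longlonglongrightarrow> (\<Sum>i<N. 0)"
      by (intro tendsto_sum rigid fib e)
    then have "\<forall>\<^sub>F n in sequentially. (\<Sum>i<N. prob {x \<in> fib (e i). \<phi> (a n) x \<notin> fib (e i)}) < r / 2"
      using \<open>r > 0\<close> by (intro order_tendstoD) auto
    moreover have "\<forall>\<^sub>F n in sequentially. \<forall>i\<in>{..<N}. a n \<otimes>\<^bsub>G\<^esub> e i = e i \<otimes>\<^bsub>G\<^esub> a n"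
      using central e by (intro eventually_ball_finite) (auto simp: central_sequence_def)
    ultimately have "\<forall>\<^sub>F n in sequentially. prob (bad n) < r"
    proof eventually_elim
      case (elim n)
      have meas: "{x \<in> fib (e i). \<phi> (a n) x \<notin> fib (e i)} \<in> sets M" for i
      proof -
        have "{x \<in> fib (e i). \<phi> (a n) x \<notin> fib (e i)} = fib (e i) - {x \<in> space M. \<phi> (a n) x \<in> fib (e i)}"
          by (auto simp: fib_def)
        then show ?thesis using fib[OF e[of i]] by simp
      qed
      have "bad n \<subseteq> (\<Union>i<N. {x \<in> fib (e i). \<phi> (a n) x \<notin> fib (e i)}) \<union> (space M - (\<Union>i<N. fib (e i)))"
      proof
        fix x assume x: "x \<in> bad n"
        show "x \<in> (\<Union>i<N. {x \<in> fib (e i). \<phi> (a n) x \<notin> fib (e i)}) \<union> (space M - (\<Union>i<N. fib (e i)))"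
        proof (cases "\<exists>i<N. x \<in> fib (e i)")
          case True
          then obtain i where i: "i < N" "x \<in> fib (e i)" by blast
          then have "a n \<otimes>\<^bsub>G\<^esub> S x = S x \<otimes>\<^bsub>G\<^esub> a n" using elim(2) by (simp add: fib_def)
          then have "S (\<phi> (a n) x) \<noteq> S x" using x by (auto simp: bad_def)
          then show ?thesis using i by (auto simp: fib_def)
        next
          case False then show ?thesis using x by (auto simp: bad_def)
        qed
      qed
      then have "prob (bad n) \<le> prob ((\<Union>i<N. {x \<in> fib (e i). \<phi> (a n) x \<notin> fib (e i)}) \<union> (space M - (\<Union>i<N. fib (e i))))"
        using meas fib[OF e] by (intro finite_measure_mono) auto
      also have "\<dots> \<le> prob (\<Union>i<N. {x \<in> fib (e i). \<phi> (a n) x \<notin> fib (e i)}) + prob (space M - (\<Union>i<N. fib (e i)))"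
        using meas fib[OF e] by (intro measure_Un_le) auto
      also have "prob (\<Union>i<N. {x \<in> fib (e i). \<phi> (a n) x \<notin> fib (e i)}) \<le>
          (\<Sum>i<N. prob {x \<in> fib (e i). \<phi> (a n) x \<notin> fib (e i)})"
        using meas by (intro measure_UNION_le) auto
      finally show ?case using elim(1) tail by linarith
    qed
    then show "\<exists>no. \<forall>n\<ge>no. norm (prob (bad n) - 0) < r" by (auto simp: eventually_sequentially)
  qed
  then show "(\<lambda>n. prob {x \<in> space M. full_group_comp G \<phi> (\<lambda>_. a n) S x \<noteq> full_group_comp G \<phi> S (\<lambda>_. a n) x})
      \<longlonglongrightarrow> 0"
    by (simp add: bad_def full_group_comp_def induced_map_def)
qed

lemma standard_borel_embed_measure:
  fixes M :: "'x::topological_space measure" and \<iota> :: "'x \<Rightarrow> 'y"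
  assumes "sets M = sets borel" "completely_metrizable_space (euclidean :: 'x topology)"
    "second_countable (euclidean :: 'x topology)" and inj: "inj \<iota>"
  shows "standard_borel (embed_measure M \<iota>)"
proof -
  have sp: "space M = UNIV" using sets_eq_imp_space_eq[OF assms(1)] by simp
  define T where "T = pullback_topology (range \<iota>) (inv_into UNIV \<iota>) (euclidean :: 'x topology)"
  have top: "topspace T = range \<iota>" by (simp add: T_def topspace_pullback_topology)
  have vim: "inv_into UNIV \<iota> -` U \<inter> range \<iota> = \<iota> ` U" for U using inj by auto
  have op: "openin T V \<longleftrightarrow> (\<exists>U. open U \<and> V = \<iota> ` U)" for V
    by (simp add: T_def openin_pullback_topology vim)
  have "homeomorphic_map euclidean T \<iota>"
  proof (rule bijective_open_imp_homeomorphic_map)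
    show "continuous_map euclidean T \<iota>"
      using inj top by (auto simp: continuous_map_def op inj_image_mem_iff)
    show "open_map euclidean T \<iota>" by (auto simp: open_map_def op)
  qed (use inj top in auto)
  then have hs: "(euclidean :: 'x topology) homeomorphic_space T"
    by (rule homeomorphic_map_imp_homeomorphic_space)
  have "sets (embed_measure M \<iota>) = (\<lambda>A. \<iota> ` A) ` sigma_sets UNIV {U. open U}"
    using inj by (auto simp: sets_embed_measure assms(1) sets_borel)
  also have "\<dots> = sigma_sets (range \<iota>) ((\<lambda>A. \<iota> ` A) ` {U. open U})"
  proof -
    have "{inv_into UNIV \<iota> -` A \<inter> range \<iota> |A. A \<in> sigma_sets UNIV {U. open U}} =
        sigma_sets (range \<iota>) {inv_into UNIV \<iota> -` A \<inter> range \<iota> |A. A \<in> {U. open U}}"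
      by (rule sigma_sets_vimage_commute) auto
    then show ?thesis unfolding vim by (simp add: Setcompr_eq_image image_Collect)
  qed
  also have "(\<lambda>A. \<iota> ` A) ` {U. open U} = {V. openin T V}" by (auto simp: op)
  finally have "sets (embed_measure M \<iota>) = sigma_sets (space (embed_measure M \<iota>)) {V. openin T V}"
    by (simp add: space_embed_measure sp)
  then show ?thesis
    unfolding standard_borel_def
    using top hs assms homeomorphic_completely_metrizable_space[OF hs]
      homeomorphic_space_second_countability[OF hs]
    by (intro exI[of _ T]) (auto simp: space_embed_measure sp)
qed

lemma schmidt_action_constant:
  assumes G: "group G" "countable (carrier G)" and act: "pmp_action G M \<phi>"
    and free: "free_action G M \<phi>"
    and central: "central_sequence G a" and nontrivial: "\<And>n. a n \<noteq> \<one>\<^bsub>G\<^esub>"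
    and fixed: "\<And>n. {x \<in> space M. \<phi> (a n) x = x} \<in> sets M"
    and rigid: "\<And>E. E \<in> sets M \<Longrightarrow> (\<lambda>n. measure M {x \<in> E. \<phi> (a n) x \<notin> E}) \<longlonglongrightarrow> 0"
  shows "schmidt_action G M \<phi>"
  unfolding schmidt_action_def
proof (intro exI conjI)
  show "full_group_central_sequence G M \<phi> (\<lambda>n _. a n)"
    by (rule full_group_central_sequence_constant[OF G act central rigid])
  interpret prob_space M using act by (simp add: pmp_action_def standard_prob_space_def)
  have "prob {x \<in> space M. \<phi> (a n) x \<noteq> x} = 1" for n
  proof (rule prob_eq_1[THEN iffD2])
    have "{x \<in> space M. \<phi> (a n) x \<noteq> x} = space M - {x \<in> space M. \<phi> (a n) x = x}" by auto
    then show "{x \<in> space M. \<phi> (a n) x \<noteq> x} \<in> events" using fixed by auto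
    have "a n \<in> carrier G" using central by (simp add: central_sequence_def)
    with nontrivial[of n] have "\<phi> (a n) x \<noteq> x" if "stabilizer G \<phi> x = {\<one>\<^bsub>G\<^esub>}" for x
      using that by (auto simp: stabilizer_def)
    then show "AE x in M. x \<in> {x \<in> space M. \<phi> (a n) x \<noteq> x}"
      using free[unfolded free_action_def] by auto
  qed
  then show "(\<lambda>n. prob {x \<in> space M. induced_map \<phi> (\<lambda>_. a n) x \<noteq> x}) \<longlonglongrightarrow> 1"
    by (simp add: induced_map_def)
qed

text \<open>The criterion used below. The action lives on a Polish space \<open>'x\<close> and is transported to the
  reals along the injection \<open>\<iota>\<close>.\<close>

lemma schmidt_propertyI:
  fixes G :: "('g, 'r) monoid_scheme" 
    and M :: "'x :: {second_countable_topology, t2_space} measure"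
    and \<psi> :: "'g \<Rightarrow> 'x \<Rightarrow> 'x" and \<iota> :: "'x \<Rightarrow> real"
  assumes G: "group G" "countable (carrier G)"
    and M: "prob_space M" "sets M = sets borel"
    and polish: "completely_metrizable_space (euclidean :: 'x topology)" and inj: "inj \<iota>"
    and one: "\<And>x. \<psi> \<one>\<^bsub>G\<^esub> x = x"
    and mult: "\<And>g h x. g \<in> carrier G \<Longrightarrow> h \<in> carrier G \<Longrightarrow> \<psi> (g \<otimes>\<^bsub>G\<^esub> h) x = \<psi> g (\<psi> h x)"
    and mp: "\<And>g. g \<in> carrier G \<Longrightarrow> measure_preserving_map M (\<psi> g)"
    and free: "\<And>g. g \<in> carrier G \<Longrightarrow> g \<noteq> \<one>\<^bsub>G\<^esub> \<Longrightarrow> AE x in M. \<psi> g x \<noteq> x"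
    and ergodic: "\<And>E. E \<in> sets M \<Longrightarrow> (\<And>g. g \<in> carrier G \<Longrightarrow> AE x in M. \<psi> g x \<in> E \<longleftrightarrow> x \<in> E) \<Longrightarrow>
      measure M E = 0 \<or> measure M E = 1"
    and central: "central_sequence G a" and nontrivial: "\<And>n. a n \<noteq> \<one>\<^bsub>G\<^esub>"
    and lim: "AE x in M. (\<lambda>n. \<psi> (a n) x) \<longlonglongrightarrow> x"
  shows "schmidt_property G"
proof -
  interpret group G by fact
  have sp: "space M = UNIV" using sets_eq_imp_space_eq[OF M(2)] by simp
  define M' where "M' = embed_measure M \<iota>"
  define J where "J = inv_into UNIV \<iota>"
  define \<phi> where "\<phi> g = restrict (\<lambda>y. \<iota> (\<psi> g (J y))) (range \<iota>)" for g
  have J [simp]: "J (\<iota> x) = x" for x using inj by (simp add: J_def)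
  have \<phi> [simp]: "\<phi> g (\<iota> x) = \<iota> (\<psi> g x)" for g x by (simp add: \<phi>_def)
  have \<iota>_eq [simp]: "\<iota> x = \<iota> y \<longleftrightarrow> x = y" for x y using inj by (rule inj_eq)
  have sp': "space M' = range \<iota>" by (simp add: M'_def space_embed_measure sp)
  have sets': "E' \<in> sets M' \<longleftrightarrow> (\<exists>E\<in>sets M. E' = \<iota> ` E)" for E'
    using inj by (auto simp: M'_def sets_embed_measure)
  have em': "emeasure M' (\<iota> ` E) = emeasure M E" if "E \<in> sets M" for E
    unfolding M'_def using inj that
    by (subst emeasure_embed_measure) (auto simp: in_sets_embed_measure inj_vimage_image_eq sp)
  then have me': "measure M' (\<iota> ` E) = measure M E" if "E \<in> sets M" for E
    using that by (simp add: measure_def)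
  have AE': "(AE y in M'. P y) \<longleftrightarrow> (AE x in M. P (\<iota> x))" for P
    unfolding M'_def by (rule AE_embed_measure[OF inj])
  have vim: "\<phi> g -` (\<iota> ` E) \<inter> space M' = \<iota> ` (\<psi> g -` E \<inter> space M)" for g E
    by (auto simp: sp sp')
  have "prob_space M'"
    using em'[of UNIV] prob_space.emeasure_space_1[OF M(1)] M(2) sp by (intro prob_spaceI) (simp add: sp')
  moreover have "standard_borel M'"
    unfolding M'_def
  proof (rule standard_borel_embed_measure[OF M(2) polish _ inj])
    obtain B :: "'x set set" where B: "countable B" "topological_basis B"
      using ex_countable_basis by blast
    show "second_countable (euclidean :: 'x topology)"
      unfolding second_countable_def
    proof (intro exI[of _ B] conjI ballI allI impI)
      show "openin euclidean V" if "V \<in> B" for V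
        using topological_basis_open[OF B(2) that] by (simp only: open_openin)
      fix U and x :: 'x assume "openin euclidean U \<and> x \<in> U"
      then show "\<exists>V\<in>B. x \<in> V \<and> V \<subseteq> U"
        using topological_basisE[OF B(2), of U x] by (metis open_openin)
    qed (rule B)
  qed
  moreover have "group_action G (space M') \<phi>"
  proof -
    have Bij: "\<phi> g \<in> Bij (range \<iota>)" if g: "g \<in> carrier G" for g
    proof -
      have "\<psi> (inv\<^bsub>G\<^esub> g) (\<psi> g x) = x" "\<psi> g (\<psi> (inv\<^bsub>G\<^esub> g) x) = x" for x
        using g mult[of "inv\<^bsub>G\<^esub> g" g x] mult[of g "inv\<^bsub>G\<^esub> g" x] by (simp_all add: one)
      then have "bij_betw (\<phi> g) (range \<iota>) (range \<iota>)"
        by (intro bij_betw_byWitness[where f' = "\<phi> (inv\<^bsub>G\<^esub> g)"]) auto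
      then show ?thesis by (simp add: Bij_def \<phi>_def)
    qed
    have "\<phi> (g \<otimes>\<^bsub>G\<^esub> h) = \<phi> g \<otimes>\<^bsub>BijGroup (range \<iota>)\<^esub> \<phi> h" if "g \<in> carrier G" "h \<in> carrier G" for g h
      using that Bij by (auto simp: BijGroup_def compose_def \<phi>_def mult fun_eq_iff)
    then have "\<phi> \<in> hom G (BijGroup (range \<iota>))"
      using Bij by (intro homI) (auto simp: BijGroup_def)
    then show ?thesis
      unfolding group_action_def group_hom_def group_hom_axioms_def sp'
      by (simp add: group_BijGroup is_group)
  qed
  moreover have "measure_preserving_map M' (\<phi> g)" if g: "g \<in> carrier G" for g
  proof -
    have \<psi>: "\<psi> g \<in> measurable M M" "distr M M (\<psi> g) = M" using mp[OF g] by (auto simp: measure_preserving_map_def)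
    have meas: "\<phi> g \<in> measurable M' M'"
    proof (rule measurableI)
      fix E' assume "E' \<in> sets M'"
      then obtain E where "E \<in> sets M" "E' = \<iota> ` E" by (auto simp: sets')
      then show "\<phi> g -` E' \<inter> space M' \<in> sets M'"
        using measurable_sets[OF \<psi>(1)] by (auto simp: vim sets' intro!: bexI[of _ "\<psi> g -` E \<inter> space M"])
    qed (auto simp: sp')
    moreover have "distr M' M' (\<phi> g) = M'"
    proof (rule measure_eqI)
      fix E' assume E': "E' \<in> sets (distr M' M' (\<phi> g))"
      then obtain E where E: "E \<in> sets M" "E' = \<iota> ` E" by (auto simp: sets')
      have "emeasure (distr M' M' (\<phi> g)) E' = emeasure M (\<psi> g -` E \<inter> space M)"
        using E' E meas measurable_sets[OF \<psi>(1) E(1)] by (simp add: emeasure_distr vim em')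
      also have "\<dots> = emeasure (distr M M (\<psi> g)) E" using E \<psi>(1) by (simp add: emeasure_distr)
      also have "\<dots> = emeasure M' E'" unfolding \<psi>(2) using E by (simp add: em')
      finally show "emeasure (distr M' M' (\<phi> g)) E' = emeasure M' E'" .
    qed simp
    ultimately show ?thesis by (simp add: measure_preserving_map_def)
  qed
  ultimately have act: "pmp_action G M' \<phi>"
    by (simp add: pmp_action_def standard_prob_space_def)
  have "AE x in M. \<forall>g\<in>carrier G - {\<one>\<^bsub>G\<^esub>}. \<psi> g x \<noteq> x"
    using G(2) free by (intro AE_ball_countable[THEN iffD2]) auto
  then have "AE x in M. stabilizer G \<phi> (\<iota> x) = {\<one>\<^bsub>G\<^esub>}"
    by eventually_elim (auto simp: stabilizer_def one)
  then have free': "free_action G M' \<phi>"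
    by (simp add: free_action_def AE')
  have "ergodic_action G M' \<phi>"
    unfolding ergodic_action_def
  proof (intro ballI impI)
    fix E' assume "E' \<in> sets M'" and inv: "\<forall>g\<in>carrier G. AE y in M'. \<phi> g y \<in> E' \<longleftrightarrow> y \<in> E'"
    then obtain E where E: "E \<in> sets M" "E' = \<iota> ` E" by (auto simp: sets')
    have "AE x in M. \<psi> g x \<in> E \<longleftrightarrow> x \<in> E" if "g \<in> carrier G" for g
      using inv that unfolding AE' E by (auto simp: image_iff)
    from ergodic[OF E(1) this] show "measure M' E' = 0 \<or> measure M' E' = 1" using E by (simp add: me')
  qed
  moreover have "schmidt_action G M' \<phi>"
  proof (rule schmidt_action_constant[OF G act free' central nontrivial])
    have a: "a n \<in> carrier G" for n using central by (simp add: central_sequence_def)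
    have [measurable]: "\<psi> (a n) \<in> borel_measurable borel" for n
      using mp[OF a] M(2) by (simp add: measure_preserving_map_def cong: measurable_cong_sets)
    show "{y \<in> space M'. \<phi> (a n) y = y} \<in> sets M'" for n
    proof -
      have "{y \<in> space M'. \<phi> (a n) y = y} = \<iota> ` {x. \<psi> (a n) x = x}" by (auto simp: sp')
      moreover have "{x. \<psi> (a n) x = x} \<in> sets borel"
      proof -
        \<comment> \<open>The fixed points form the preimage of the closed diagonal.\<close>
        have "(\<lambda>x. (\<psi> (a n) x, x)) \<in> borel_measurable borel" by (intro borel_measurable_Pair) simp_all
        moreover have "{y :: 'x \<times> 'x. \<exists>x. y = (x, x)} \<in> sets borel"
          by (intro borel_closed closed_diagonal)
        ultimately have "(\<lambda>x. (\<psi> (a n) x, x)) -` {y. \<exists>x. y = (x, x)} \<inter> space borel \<in> sets borel"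
          by (rule measurable_sets)
        moreover have "(\<lambda>x. (\<psi> (a n) x, x)) -` {y. \<exists>x. y = (x, x)} = {x. \<psi> (a n) x = x}" by auto
        ultimately show ?thesis by simp
      qed
      ultimately show ?thesis using M(2) unfolding sets' by blast
    qed
    fix E' assume "E' \<in> sets M'"
    then obtain E where E: "E \<in> sets M" "E' = \<iota> ` E" by (auto simp: sets')
    have eq: "{y \<in> E'. \<phi> (a n) y \<notin> E'} = \<iota> ` {x \<in> E. \<psi> (a n) x \<notin> E}" for n
      by (auto simp: E image_iff)
    have "E - (\<psi> (a n) -` E \<inter> space M) \<in> sets M" for n
      using E mp[OF a, of n] by (intro sets.Diff measurable_sets[of _ M M]) (auto simp: measure_preserving_map_def)
    moreover have "{x \<in> E. \<psi> (a n) x \<notin> E} = E - (\<psi> (a n) -` E \<inter> space M)" for n by (auto simp: sp)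
    ultimately have "measure M' {y \<in> E'. \<phi> (a n) y \<notin> E'} = measure M {x \<in> E. \<psi> (a n) x \<notin> E}" for n
      unfolding eq by (simp add: me')
    then show "(\<lambda>n. measure M' {y \<in> E'. \<phi> (a n) y \<notin> E'}) \<longlonglongrightarrow> 0"
      using measure_escape_tendsto_0_if_pointwise[OF M mp[OF a] lim E(1)] by simp
  qed
  ultimately show ?thesis
    unfolding schmidt_property_def using act free' by blast
qed

section \<open>Embedding the phase spaces into the reals\<close>

text \<open>Real and imaginary parts are coded as sets of natural numbers, and all these sets are merged into
  a single one.\<close>

lemma nat_complex_functions_inject_into_reals: "\<exists>\<iota> :: (nat \<Rightarrow> complex) \<Rightarrow> real. inj \<iota>"
proof -
  obtain f :: "real \<Rightarrow> nat set" where f: "inj f"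
    using nat_sets_eqpoll_reals eqpoll_sym unfolding eqpoll_def bij_betw_def by metis
  obtain k :: "nat set \<Rightarrow> real" where k: "inj k"
    using nat_sets_eqpoll_reals unfolding eqpoll_def bij_betw_def by metis
  define c where "c x = {prod_encode (i, 2 * n) |i n. n \<in> f (Re (x i))} \<union> {prod_encode (i, 2 * n + 1) |i n. n \<in> f (Im (x i))}"
    for x :: "nat \<Rightarrow> complex"
  have 1: "prod_encode (i, 2 * n) \<in> c x \<longleftrightarrow> n \<in> f (Re (x i))" for i n x
    unfolding c_def by (auto simp: prod_encode_eq) presburger
  have 2: "prod_encode (i, 2 * n + 1) \<in> c x \<longleftrightarrow> n \<in> f (Im (x i))" for i n x
    unfolding c_def by (auto simp: prod_encode_eq) presburger
  have "inj c"
  proof (rule injI)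
    fix x y assume eq: "c x = c y"
    have "f (Re (x i)) = f (Re (y i))" "f (Im (x i)) = f (Im (y i))" for i
      using 1[of i _ x] 1[of i _ y] 2[of i _ x] 2[of i _ y] eq by blast+
    then show "x = y" using f by (auto simp: inj_eq fun_eq_iff complex_eq_iff)
  qed
  then have "inj (k \<circ> c)" using k by (simp add: inj_compose)
  then show ?thesis by blast
qed

lemma pair_functions_inject_into_reals: "\<exists>\<iota> :: nat \<times> (nat \<Rightarrow> complex) \<Rightarrow> real. inj \<iota>"
proof -
  obtain \<iota> :: "(nat \<Rightarrow> complex) \<Rightarrow> real" where \<iota>: "inj \<iota>" using nat_complex_functions_inject_into_reals by blast
  have "inj (\<lambda>(p, x). case_nat (of_nat p :: complex) x)"
  proof (rule injI, clarify)
    fix p p' :: nat and x x' :: "nat \<Rightarrow> complex"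
    assume eq: "case_nat (of_nat p) x = case_nat (of_nat p') x'"
    then have "(of_nat p :: complex) = of_nat p'" by (metis nat.case(1))
    moreover have "x i = x' i" for i using eq by (metis nat.case(2))
    ultimately show "p = p' \<and> x = x'" by auto
  qed
  then have "inj (\<iota> \<circ> (\<lambda>(p, x). case_nat (of_nat p :: complex) x))" using \<iota> by (rule inj_compose[rotated])
  then show ?thesis by blast
qed

lemma completely_metrizable_space_pair_functions:
  "completely_metrizable_space (euclidean :: (nat \<times> (nat \<Rightarrow> complex)) topology)"
proof -
  have 1: "(euclidean :: nat topology) = discrete_topology UNIV"
    by (simp add: topology_eq open_openin[symmetric] discrete_topology_class.open_discrete)
  have 2: "(euclidean :: (nat \<times> (nat \<Rightarrow> complex)) topology) = prod_topology euclidean euclidean"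
    unfolding topology_eq openin_prod_topology_alt open_prod_def open_openin[symmetric]
    by (auto, (metis mem_Sigma_iff)+)
  show ?thesis
    unfolding 2 completely_metrizable_space_prod_topology
    using completely_metrizable_space_discrete_topology[of "UNIV :: nat set"]
    by (simp add: 1 completely_metrizable_space_euclidean)
qed

section \<open>Co-induction from a subgroup of infinite index\<close>

context coset_cocycle
begin

text \<open>This is why \<open>a\<close> acts almost trivially in the induced and in the co-induced action.\<close>

lemma central_eventually_fixes:
  assumes a: "central_sequence G a" "\<And>n. a n \<in> A" and p: "p \<in> P"
  shows "\<forall>\<^sub>F n in sequentially. perm (a n) p = p \<and> perm (inv (a n)) p = p \<and> cocycle (a n) p = a n"
proof -
  have "\<forall>\<^sub>F n in sequentially. a n \<otimes> s p = s p \<otimes> a n"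
    using a(1) s_closed[OF p] by (simp add: central_sequence_def)
  then show ?thesis
  proof eventually_elim
    case (elim n)
    have "a n \<in> carrier G" using a(2) A.subset by auto
    then show ?case using perm_cocycle_commuting[OF p a(2) elim] perm_inv(1)[of "a n" p] by simp
  qed
qed

text \<open>The co-induced action is \<open>(g x)\<^sub>q\<^sub>j = \<theta>\<^sub>j (cocycle g p) x\<^sub>p\<^sub>j\<close> with \<open>q = perm g p\<close>, where the pair
  \<open>(q, j)\<close> is coded by a natural number. A nontrivial \<open>g\<close> has almost no fixed
  points: if it moves a coset, a fixed point satisfies a relation between two independent coordinates;
  if it fixes all cosets, its cocycle values are nontrivial and are detected by some \<open>\<theta>\<^sub>j\<close>.\<close>

lemma schmidt_property_infinite_index:
  fixes \<theta> :: "nat \<Rightarrow> 'a \<Rightarrow> complex"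
  assumes countable: "countable (carrier G)" and P: "P = UNIV"
    and \<theta>: "\<And>j. character (G\<lparr>carrier := A\<rparr>) (\<theta> j)"
    and separating: "\<And>x. x \<in> A \<Longrightarrow> x \<noteq> \<one> \<Longrightarrow> \<exists>j. \<theta> j x \<noteq> 1"
    and a: "central_sequence G a" "\<And>n. a n \<in> A" "\<And>n. a n \<noteq> \<one>" "\<And>j. (\<lambda>n. \<theta> j (a n)) \<longlonglongrightarrow> 1"
  shows "schmidt_property G"
proof -
  have \<theta>_norm: "norm (\<theta> j x) = 1" if "x \<in> A" for j x using \<theta>[of j] that by (simp add: character_def)
  have \<theta>_mult: "\<theta> j (x \<otimes> y) = \<theta> j x * \<theta> j y" if "x \<in> A" "y \<in> A" for j x y
    using \<theta>[of j] that by (simp add: character_def)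
  have \<theta>_one: "\<theta> j \<one> = 1" for j
    using \<theta>_mult[of \<one> \<one> j] \<theta>_norm[of \<one> j] by (auto simp: mult_cancel_right1)
  define \<tau> where "\<tau> g i = prod_encode (perm g (fst (prod_decode i)), snd (prod_decode i))" for g i
  define c where "c g i = \<theta> (snd (prod_decode i)) (cocycle g (perm (inv g) (fst (prod_decode i))))" for g i
  define \<psi> where "\<psi> g = affine_map (c g) (\<tau> (inv g))" for g
  have \<psi>_encode: "\<psi> g x (prod_encode (q, j)) = \<theta> j (cocycle g (perm (inv g) q)) * x (prod_encode (perm (inv g) q, j))" for g x q j
    by (simp add: \<psi>_def affine_map_def c_def \<tau>_def)
  have cocA: "cocycle g p \<in> A" if "g \<in> carrier G" for g p using cocycle_closed[OF that] P by simp
  have c_torus: "c g \<in> torus" if "g \<in> carrier G" for g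
    using cocA[OF that] by (simp add: torus_def c_def \<theta>_norm)
  have \<tau>_inv: "\<tau> g (\<tau> (inv g) i) = i" "\<tau> (inv g) (\<tau> g i) = i" if "g \<in> carrier G" for g i
    using that by (simp_all add: \<tau>_def perm_inv)
  obtain \<mu> where \<mu>: "haar_law {\<lambda>_. 0} \<mu>" using haar_law_exists[OF relation_group_zero] by blast
  obtain \<iota> :: "(nat \<Rightarrow> complex) \<Rightarrow> real" where \<iota>: "inj \<iota>" using nat_complex_functions_inject_into_reals by blast
  have eqI: "x = y" if "\<And>q j. x (prod_encode (q, j)) = y (prod_encode (q, j))" for x y :: "nat \<Rightarrow> complex"
  proof
    fix i show "x i = y i" using that[of "fst (prod_decode i)" "snd (prod_decode i)"] by simp
  qed
  have mp: "measure_preserving_map \<mu> (\<psi> g)" if g: "g \<in> carrier G" for g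
    unfolding \<psi>_def
  proof (rule measure_preserving_affine_map[OF \<mu> c_torus[OF g] \<tau>_inv(2)[OF g] \<tau>_inv(1)[OF g]])
    fix n :: "nat \<Rightarrow> int"
    show "(\<lambda>i. n (\<tau> g i)) \<in> {\<lambda>_. 0} \<longleftrightarrow> n \<in> {\<lambda>_. 0}"
      using \<tau>_inv(1)[OF g] by (auto simp: fun_eq_iff) (metis)
    show "monomial n (c g) = 1" if "n \<in> {\<lambda>_. 0}" using that by (simp add: monomial_def)
  qed
  show ?thesis
  proof (rule schmidt_propertyI[where M = \<mu> and \<psi> = \<psi> and \<iota> = \<iota> and a = a])
    show "group G" by (rule is_group)
    show "prob_space \<mu>" "sets \<mu> = sets borel" by (rule haar_law_prob_space[OF \<mu>], rule haar_law_sets[OF \<mu>])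
    show "completely_metrizable_space (euclidean :: (nat \<Rightarrow> complex) topology)"
      by (rule completely_metrizable_space_euclidean)
    show "\<psi> \<one> x = x" for x by (rule eqI) (simp add: \<psi>_encode perm_one cocycle_one \<theta>_one)
    show "\<psi> (g \<otimes> h) x = \<psi> g (\<psi> h x)" if g: "g \<in> carrier G" and h: "h \<in> carrier G" for g h x
    proof (rule eqI)
      fix q j
      define p where "p = perm (inv h) (perm (inv g) q)"
      have "perm (inv (g \<otimes> h)) q = p" using g h by (simp add: p_def inv_mult_group perm_mult)
      moreover have "perm h p = perm (inv g) q" using h by (simp add: p_def perm_inv)
      ultimately show "\<psi> (g \<otimes> h) x (prod_encode (q, j)) = \<psi> g (\<psi> h x) (prod_encode (q, j))"
        using g h cocA by (simp add: \<psi>_encode cocycle_mult \<theta>_mult p_def[symmetric])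
    qed
    show "measure_preserving_map \<mu> (\<psi> g)" if "g \<in> carrier G" for g using that by (rule mp)
    show "AE x in \<mu>. \<psi> g x \<noteq> x" if g: "g \<in> carrier G" "g \<noteq> \<one>" for g
    proof (cases "\<exists>p. perm g p \<noteq> p")
      case True
      then obtain p where p: "perm g p \<noteq> p" by blast
      have "AE x in \<mu>. x (prod_encode (perm g p, 0)) \<noteq> \<theta> 0 (cocycle g p) * x (prod_encode (p, 0))"
        by (rule haar_law_AE_coordinates_unrelated[OF \<mu>]) (use p \<theta>_norm cocA[OF g(1)] in \<open>auto simp: prod_encode_eq\<close>)
      then show ?thesis
      proof eventually_elim
        case (elim x)
        then show ?case using \<psi>_encode[of g x "perm g p" 0] g by (auto simp: perm_inv)
      qed
    next
      case False
      then have fix_p: "perm g p = p" for p by blast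
      then have "cocycle g 0 \<noteq> \<one>" using cocycle_nontrivial[OF g, of 0] P by simp
      then obtain j where j: "\<theta> j (cocycle g 0) \<noteq> 1" using separating cocA[OF g(1)] by blast
      show ?thesis
        using haar_law_AE_torus[OF \<mu>]
      proof eventually_elim
        case (elim x)
        have "norm (x (prod_encode (0, j))) = 1" using elim by (simp add: torus_def)
        then have "x (prod_encode (0, j)) \<noteq> 0" by (metis norm_zero zero_neq_one)
        moreover have "perm (inv g) 0 = 0" using perm_inv(1)[OF g(1), of 0] fix_p by simp
        ultimately have "\<psi> g x (prod_encode (0, j)) \<noteq> x (prod_encode (0, j))"
          using j by (simp add: \<psi>_encode)
        then show ?case by auto
      qed
    qed
    show "measure \<mu> E = 0 \<or> measure \<mu> E = 1"
      if E: "E \<in> sets \<mu>" and inv: "\<And>g. g \<in> carrier G \<Longrightarrow> AE x in \<mu>. \<psi> g x \<in> E \<longleftrightarrow> x \<in> E" for E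
    proof (rule haar_law_trivial_if_coefficients_vanish[OF \<mu> relation_group_zero E])
      fix n :: "nat \<Rightarrow> int" assume n: "finite {i. n i \<noteq> 0}" "n \<notin> {\<lambda>_. 0}"
      then obtain i0 where i0: "n i0 \<noteq> 0" by auto
      \<comment> \<open>The translates of \<open>monomial n\<close> have infinitely many exponents \<open>m g\<close>, because for every coset \<open>q\<close>
        the pair \<open>(q, j0)\<close> lies in the support of one of them.\<close>
      define p0 j0 where "p0 = fst (prod_decode i0)" and "j0 = snd (prod_decode i0)"
      define m where "m g = (\<lambda>i. n (\<tau> g i))" for g
      have fin: "finite {i. m g i \<noteq> 0}" if "g \<in> carrier G" for g
        unfolding m_def by (rule finite_support_reindex[of n "\<tau> (inv g)"]) (use n \<tau>_inv[OF that] in auto)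
      have "infinite (m ` carrier G)"
      proof
        assume "finite (m ` carrier G)"
        then have "finite (\<Union>k\<in>m ` carrier G. {i. k i \<noteq> 0})" by (rule finite_UN_I) (use fin in auto)
        moreover have "range (\<lambda>q. prod_encode (q, j0)) \<subseteq> (\<Union>k\<in>m ` carrier G. {i. k i \<noteq> 0})"
        proof (clarify)
          fix q
          obtain g where g: "g \<in> carrier G" "perm g q = p0" using perm_transitive[of q p0] P by auto
          have "m g (prod_encode (q, j0)) = n i0" by (simp add: m_def \<tau>_def g p0_def j0_def)
          then show "prod_encode (q, j0) \<in> (\<Union>k\<in>m ` carrier G. {i. k i \<noteq> 0})" using g i0 by force
        qed
        moreover have "infinite (range (\<lambda>q. prod_encode (q, j0)))"
          by (simp add: finite_image_iff inj_on_def prod_encode_eq)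
        ultimately show False using finite_subset by blast
      qed
      then have "cmod (\<integral>x. indicator E x *\<^sub>R monomial n x \<partial>\<mu>) = 0"
      proof (rule haar_law_constant_coefficients_zero[OF \<mu> E])
        fix k assume "k \<in> m ` carrier G"
        then obtain g where g: "g \<in> carrier G" and k: "k = m g" by blast
        show "finite {i. k i \<noteq> 0}" using fin[OF g] k by simp
        have "monomial n (\<psi> g x) = monomial n (c g) * monomial k x" for x
          unfolding \<psi>_def k m_def by (rule monomial_affine_map) (use \<tau>_inv[OF g] in auto)
        then have "(\<integral>x. indicator E x *\<^sub>R monomial n x \<partial>\<mu>) =
            (\<integral>x. monomial n (c g) * (indicator E x *\<^sub>R monomial k x) \<partial>\<mu>)"
          using integral_indicator_monomial_invariant[OF \<mu> mp[OF g] E inv[OF g], of n] by simp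
        also have "\<dots> = monomial n (c g) * (\<integral>x. indicator E x *\<^sub>R monomial k x \<partial>\<mu>)"
          by (rule integral_mult_right_zero)
        finally show "cmod (\<integral>x. indicator E x *\<^sub>R monomial k x \<partial>\<mu>) = cmod (\<integral>x. indicator E x *\<^sub>R monomial n x \<partial>\<mu>)"
          using norm_monomial[OF c_torus[OF g]] by (simp add: norm_mult)
      qed
      then show "(\<integral>x. indicator E x *\<^sub>R monomial n x \<partial>\<mu>) = 0" by simp
    qed
    have "(\<lambda>n. \<psi> (a n) x) \<longlonglongrightarrow> x" for x
      unfolding tendsto_coordinate
    proof
      fix i
      obtain q j where i: "i = prod_encode (q, j)" by (metis prod_decode_inverse surj_pair)
      have "\<forall>\<^sub>F n in sequentially. \<theta> j (a n) * x i = \<psi> (a n) x i"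
        using central_eventually_fixes[OF a(1,2), of q] P
        by (auto elim!: eventually_mono simp: i \<psi>_encode)
      moreover have "(\<lambda>n. \<theta> j (a n) * x i) \<longlonglongrightarrow> 1 * x i" by (intro tendsto_mult_right a(4))
      ultimately show "(\<lambda>n. \<psi> (a n) x i) \<longlonglongrightarrow> x i"
        using tendsto_cong by fastforce
    qed
    then show "AE x in \<mu>. (\<lambda>n. \<psi> (a n) x) \<longlonglongrightarrow> x" by simp
  qed (fact countable \<iota> a)+
qed

end

section \<open>Induction from a subgroup of finite index\<close>

context coset_cocycle
begin

text \<open>The induced action is \<open>g (p, u) = (perm g p, \<theta> (cocycle g p) u)\<close> on \<open>P \<times> torus\<close>, with the uniform
  measure on \<open>P\<close> and the Haar measure \<open>\<nu>\<close> of the closure of \<open>A\<close>. An invariant set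
  has slices of equal measure by transitivity, and the slice over \<open>p0\<close> is invariant under \<open>A\<close>. A
  monomial that is nontrivial on \<open>A\<close> is multiplied by a scalar different from \<open>1\<close> under some element
  of \<open>A\<close>, so the corresponding coefficient of this slice vanishes.\<close>

lemma schmidt_property_finite_index:
  fixes \<theta> :: "nat \<Rightarrow> 'a \<Rightarrow> complex"
  assumes countable: "countable (carrier G)" and P: "finite P" "P \<noteq> {}"
    and \<theta>: "\<And>j. character (G\<lparr>carrier := A\<rparr>) (\<theta> j)"
    and separating: "\<And>x. x \<in> A \<Longrightarrow> x \<noteq> \<one> \<Longrightarrow> \<exists>j. \<theta> j x \<noteq> 1"
    and a: "central_sequence G a" "\<And>n. a n \<in> A" "\<And>n. a n \<noteq> \<one>" "\<And>j. (\<lambda>n. \<theta> j (a n)) \<longlonglongrightarrow> 1"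
  shows "schmidt_property G"
proof -
  have \<theta>_norm: "norm (\<theta> j x) = 1" if "x \<in> A" for j x using \<theta>[of j] that by (simp add: character_def)
  have \<theta>_mult: "\<theta> j (x \<otimes> y) = \<theta> j x * \<theta> j y" if "x \<in> A" "y \<in> A" for j x y
    using \<theta>[of j] that by (simp add: character_def)
  have \<theta>_one: "\<theta> j \<one> = 1" for j
    using \<theta>_mult[of \<one> \<one> j] \<theta>_norm[of \<one> j] by (auto simp: mult_cancel_right1)
  define ev where "ev x = (\<lambda>j. \<theta> j x)" for x
  have ev_torus: "ev x \<in> torus" if "x \<in> A" for x using that by (simp add: ev_def torus_def \<theta>_norm)
  define R where "R = {n. finite {i. n i \<noteq> 0} \<and> (\<forall>x\<in>A. monomial n (ev x) = 1)}"
  have R: "relation_group R"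
    unfolding relation_group_def
  proof (intro conjI ballI)
    show "(\<lambda>_. 0) \<in> R" by (simp add: R_def monomial_def)
    show "finite {i. n i \<noteq> 0}" if "n \<in> R" for n using that by (simp add: R_def)
    fix n m assume nm: "n \<in> R" "m \<in> R"
    then have fin: "finite {i. n i \<noteq> 0}" "finite {i. m i \<noteq> 0}" by (auto simp: R_def)
    have "finite {i. n i - m i \<noteq> 0}"
      by (rule finite_subset[OF _ finite_UnI[OF fin]]) auto
    moreover have "monomial (\<lambda>i. n i - m i) (ev x) = 1" if x: "x \<in> A" for x
      using monomial_add[OF ev_torus[OF x] fin(1), of "\<lambda>i. - m i"] fin nm x
      by (simp add: cnj_monomial[OF ev_torus[OF x], symmetric] R_def)
    ultimately show "(\<lambda>i. n i - m i) \<in> R" by (simp add: R_def)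
  qed
  obtain \<nu> where \<nu>: "haar_law R \<nu>" using haar_law_exists[OF R] by blast
  define T where "T x = affine_map (ev x) id" for x
  have mp_T: "measure_preserving_map \<nu> (T x)" if "x \<in> A" for x
    unfolding T_def using that
    by (intro measure_preserving_affine_map[OF \<nu> ev_torus[OF that], of id id]) (auto simp: R_def)
  have T_mult: "T (x \<otimes> y) u = T x (T y u)" if "x \<in> A" "y \<in> A" for x y u
    using that by (simp add: T_def affine_map_def ev_def \<theta>_mult fun_eq_iff)
  have T_one: "T \<one> u = u" for u by (simp add: T_def affine_map_def ev_def \<theta>_one fun_eq_iff)
  have cocA: "cocycle g p \<in> A" if "g \<in> carrier G" for g p
    using cocycle_closed[OF that] by (cases "p \<in> P") auto
  define \<psi> where "\<psi> g = (\<lambda>(p, u). (perm g p, T (cocycle g p) u))" for g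
  interpret \<nu>: prob_space \<nu> by (rule haar_law_prob_space[OF \<nu>])
  define U where "U = measure_pmf (pmf_of_set P)"
  have AE_U: "(AE p in U. Q p) \<longleftrightarrow> (\<forall>p\<in>P. Q p)" for Q
    using P unfolding U_def AE_measure_pmf_iff by simp
  interpret U: prob_space U unfolding U_def by (rule prob_space_measure_pmf)
  interpret UV: pair_prob_space U \<nu> ..
  define M where "M = U \<Otimes>\<^sub>M \<nu>"
  have sets_M: "sets M = sets borel"
  proof -
    have "sets M = sets ((borel :: nat measure) \<Otimes>\<^sub>M (borel :: (nat \<Rightarrow> complex) measure))"
      unfolding M_def by (rule sets_pair_measure_cong) (simp_all add: U_def sets_borel_eq_count_space haar_law_sets[OF \<nu>])
    then show ?thesis unfolding borel_prod .
  qed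
  have space_M: "space M = UNIV" using sets_eq_imp_space_eq[OF sets_M] by simp
  have prob_M: "prob_space M" unfolding M_def by (rule UV.prob_space_axioms)
  have slice: "{u. (p, u) \<in> B} \<in> sets \<nu>" if "B \<in> sets M" for B p
    using sets_Pair1[of B U \<nu> p] that by (simp add: M_def vimage_def)
  have em: "emeasure M B = (\<Sum>p\<in>P. emeasure \<nu> {u. (p, u) \<in> B}) / card P" if "B \<in> sets M" for B
  proof -
    have "emeasure M B = (\<integral>\<^sup>+p. emeasure \<nu> (Pair p -` B) \<partial>U)"
      unfolding M_def using that by (intro \<nu>.emeasure_pair_measure_alt) (simp add: M_def)
    then show ?thesis using P by (simp add: U_def nn_integral_pmf_of_set vimage_def)
  qed
  have bij_perm: "bij_betw (perm g) P P" if g: "g \<in> carrier G" for g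
    by (rule bij_betw_byWitness[where f' = "perm (inv g)"]) (use g perm_closed perm_inv in auto)
  have \<psi>_meas: "\<psi> g \<in> measurable M M" for g
  proof -
    have "(\<lambda>(p, u). (perm g p, T (cocycle g p) u)) \<in> measurable (count_space UNIV \<Otimes>\<^sub>M borel) (count_space UNIV \<Otimes>\<^sub>M borel)"
    proof (rule measurable_pair_measure_countable1)
      show "(\<lambda>u. case (p, u) of (p, u) \<Rightarrow> (perm g p, T (cocycle g p) u)) \<in> measurable borel (count_space UNIV \<Otimes>\<^sub>M borel)" for p
        unfolding T_def by simp
    qed simp
    moreover have "sets M = sets (count_space UNIV \<Otimes>\<^sub>M borel)"
      unfolding M_def by (rule sets_pair_measure_cong) (simp_all add: U_def haar_law_sets[OF \<nu>])
    ultimately show ?thesis unfolding \<psi>_def by (simp cong: measurable_cong_sets)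
  qed
  have mp: "measure_preserving_map M (\<psi> g)" if g: "g \<in> carrier G" for g
    unfolding measure_preserving_map_def
  proof (rule conjI[OF \<psi>_meas], rule measure_eqI)
    fix B assume "B \<in> sets (distr M M (\<psi> g))"
    then have B: "B \<in> sets M" by simp
    have T_em: "emeasure \<nu> {u. T (cocycle g p) u \<in> D} = emeasure \<nu> D" if D: "D \<in> sets \<nu>" for p D
    proof -
      have "emeasure \<nu> D = emeasure (distr \<nu> \<nu> (T (cocycle g p))) D"
        using mp_T[OF cocA[OF g]] by (simp add: measure_preserving_map_def)
      also have "\<dots> = emeasure \<nu> (T (cocycle g p) -` D \<inter> space \<nu>)"
        using mp_T[OF cocA[OF g]] D by (intro emeasure_distr) (simp_all add: measure_preserving_map_def)
      finally show ?thesis by (simp add: haar_law_space[OF \<nu>] vimage_def)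
    qed
    have "emeasure (distr M M (\<psi> g)) B = emeasure M (\<psi> g -` B \<inter> space M)"
      using B by (intro emeasure_distr \<psi>_meas)
    also have "\<dots> = (\<Sum>p\<in>P. emeasure \<nu> {u. (p, u) \<in> \<psi> g -` B \<inter> space M}) / card P"
      by (rule em[OF measurable_sets[OF \<psi>_meas B]])
    also have "(\<Sum>p\<in>P. emeasure \<nu> {u. (p, u) \<in> \<psi> g -` B \<inter> space M}) =
        (\<Sum>p\<in>P. emeasure \<nu> {u. (perm g p, u) \<in> B})"
      using T_em[OF slice[OF B]] by (intro sum.cong) (simp_all add: space_M \<psi>_def)
    also have "\<dots> = (\<Sum>p\<in>P. emeasure \<nu> {u. (p, u) \<in> B})"
      by (rule sum.reindex_bij_betw[OF bij_perm[OF g]])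
    finally show "emeasure (distr M M (\<psi> g)) B = emeasure M B" by (simp add: em[OF B])
  qed simp
  have AE_slice: "AE u in \<nu>. Q (p, u)" if "AE z in M. Q z" "p \<in> P" for Q p
  proof -
    have "AE p in U. AE u in \<nu>. Q (p, u)" using that(1) unfolding M_def by (rule UV.AE_pair)
    then show ?thesis using that(2) by (simp add: AE_U)
  qed
  obtain \<iota> :: "nat \<times> (nat \<Rightarrow> complex) \<Rightarrow> real" where \<iota>: "inj \<iota>" using pair_functions_inject_into_reals by blast
  show ?thesis
  proof (rule schmidt_propertyI[where M = M and \<psi> = \<psi> and \<iota> = \<iota> and a = a])
    show "group G" by (rule is_group)
    show "completely_metrizable_space (euclidean :: (nat \<times> (nat \<Rightarrow> complex)) topology)"
      by (rule completely_metrizable_space_pair_functions)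
    show "\<psi> \<one> z = z" for z by (simp add: \<psi>_def perm_one cocycle_one T_one split: prod.split)
    show "\<psi> (g \<otimes> h) z = \<psi> g (\<psi> h z)" if "g \<in> carrier G" "h \<in> carrier G" for g h z
      using that cocA by (simp add: \<psi>_def perm_mult cocycle_mult T_mult split: prod.split)
    show "AE z in M. \<psi> g z \<noteq> z" if g: "g \<in> carrier G" "g \<noteq> \<one>" for g
    proof -
      have "AE z in U \<Otimes>\<^sub>M \<nu>. z \<in> P \<times> torus"
      proof (rule UV.AE_pair_measure)
        have "P \<times> torus \<in> sets (U \<Otimes>\<^sub>M \<nu>)"
          by (rule pair_measureI) (simp_all add: U_def haar_law_sets[OF \<nu>])
        then show "{z \<in> space (U \<Otimes>\<^sub>M \<nu>). z \<in> P \<times> torus} \<in> sets (U \<Otimes>\<^sub>M \<nu>)" by simp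
        show "AE p in U. AE u in \<nu>. (p, u) \<in> P \<times> torus"
          using haar_law_AE_torus[OF \<nu>] by (simp add: AE_U)
      qed
      then have "AE z in M. z \<in> P \<times> torus" unfolding M_def .
      then show ?thesis
      proof eventually_elim
        case (elim z)
        obtain p u where z: "z = (p, u)" "p \<in> P" "u \<in> torus" using elim by auto
        show ?case
        proof (cases "perm g p = p")
          case True
          then have "cocycle g p \<noteq> \<one>" using cocycle_nontrivial[OF g z(2)] by simp
          then obtain j where j: "\<theta> j (cocycle g p) \<noteq> 1" using separating cocA[OF g(1)] by blast
          have "norm (u j) = 1" using z(3) by (simp add: torus_def)
          then have "u j \<noteq> 0" by (metis norm_zero zero_neq_one)
          then have "T (cocycle g p) u j \<noteq> u j" using j by (simp add: T_def affine_map_def ev_def)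
          then show ?thesis by (auto simp: z \<psi>_def)
        qed (simp add: z \<psi>_def)
      qed
    qed
    show "measure M E = 0 \<or> measure M E = 1"
      if E: "E \<in> sets M" and inv: "\<And>g. g \<in> carrier G \<Longrightarrow> AE z in M. \<psi> g z \<in> E \<longleftrightarrow> z \<in> E" for E
    proof -
      define D where "D p = {u. (p, u) \<in> E}" for p
      have D [measurable]: "D p \<in> sets \<nu>" for p unfolding D_def by (rule slice[OF E])
      have inv_D: "AE u in \<nu>. T (cocycle g p) u \<in> D (perm g p) \<longleftrightarrow> u \<in> D p" if "g \<in> carrier G" "p \<in> P" for g p
        using AE_slice[OF inv[OF that(1)] that(2)] by (simp add: D_def \<psi>_def)
      obtain p0 where p0: "p0 \<in> P" using P by blast
      have inv_A: "AE u in \<nu>. T x u \<in> D p0 \<longleftrightarrow> u \<in> D p0" if x: "x \<in> A" for x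
      proof -
        obtain g where "g \<in> carrier G" "perm g p0 = p0" "cocycle g p0 = x"
          by (rule cocycle_surj_stabilizer[OF p0 x])
        then show ?thesis using inv_D[of g p0] p0 by simp
      qed
      have D0: "measure \<nu> (D p0) = 0 \<or> measure \<nu> (D p0) = 1"
      proof (rule haar_law_trivial_if_coefficients_vanish[OF \<nu> R D])
        fix n :: "nat \<Rightarrow> int" assume n: "finite {i. n i \<noteq> 0}" "n \<notin> R"
        then obtain x where x: "x \<in> A" "monomial n (ev x) \<noteq> 1" by (auto simp: R_def)
        let ?v = "\<integral>u. indicator (D p0) u *\<^sub>R monomial n u \<partial>\<nu>"
        have "monomial n (T x u) = monomial n (ev x) * monomial n u" for u
          unfolding T_def by (subst monomial_affine_map[of id id]) simp_all
        then have "?v = (\<integral>u. monomial n (ev x) * (indicator (D p0) u *\<^sub>R monomial n u) \<partial>\<nu>)"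
          using integral_indicator_monomial_invariant[OF \<nu> mp_T[OF x(1)] D inv_A[OF x(1)], of n] by simp
        also have "\<dots> = monomial n (ev x) * ?v" by (rule integral_mult_right_zero)
        finally show "?v = 0" using x(2) by (simp add: mult_cancel_right1)
      qed
      have D_eq: "emeasure \<nu> (D p) = emeasure \<nu> (D p0)" if p: "p \<in> P" for p
      proof -
        obtain g where g: "g \<in> carrier G" "perm g p = p0" by (rule perm_transitive[OF p p0])
        have Tm: "T (cocycle g p) \<in> measurable \<nu> \<nu>" "distr \<nu> \<nu> (T (cocycle g p)) = \<nu>"
          using mp_T[OF cocA[OF g(1)]] by (auto simp: measure_preserving_map_def)
        have "emeasure \<nu> (D p) = emeasure \<nu> (T (cocycle g p) -` D p0 \<inter> space \<nu>)"
          using inv_D[OF g(1) p] g(2) measurable_sets[OF Tm(1) D]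
          by (intro emeasure_eq_AE) (auto simp: haar_law_space[OF \<nu>])
        also have "\<dots> = emeasure (distr \<nu> \<nu> (T (cocycle g p))) (D p0)"
          using Tm(1) D by (simp add: emeasure_distr)
        finally show ?thesis by (simp add: Tm(2))
      qed
      have "emeasure M E = (\<Sum>p\<in>P. emeasure \<nu> (D p0)) / card P"
        unfolding em[OF E] using D_eq by (simp add: D_def)
      also have "\<dots> = emeasure \<nu> (D p0)"
      proof -
        have "(of_nat (card P) :: ennreal) \<noteq> 0" using P by simp
        then have "emeasure \<nu> (D p0) * of_nat (card P) / of_nat (card P) = emeasure \<nu> (D p0)"
          by (rule mult_divide_eq_ennreal) simp
        then show ?thesis by (simp add: mult.commute)
      qed
      finally have "measure M E = measure \<nu> (D p0)" by (simp add: measure_def)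
      then show ?thesis using D0 by simp
    qed
    have "AE z in M. fst z \<in> P"
    proof -
      have "AE z in U \<Otimes>\<^sub>M \<nu>. fst z \<in> P"
      proof (rule UV.AE_pair_measure)
        have "P \<times> space \<nu> \<in> sets (U \<Otimes>\<^sub>M \<nu>)" by (rule pair_measureI) (simp_all add: U_def)
        moreover have "{z \<in> space (U \<Otimes>\<^sub>M \<nu>). fst z \<in> P} = P \<times> space \<nu>"
          by (auto simp: space_pair_measure U_def)
        ultimately show "{z \<in> space (U \<Otimes>\<^sub>M \<nu>). fst z \<in> P} \<in> sets (U \<Otimes>\<^sub>M \<nu>)" by simp
      qed (simp add: AE_U)
      then show ?thesis unfolding M_def .
    qed
    then show "AE z in M. (\<lambda>n. \<psi> (a n) z) \<longlonglongrightarrow> z"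
    proof eventually_elim
      case (elim z)
      obtain p u where z: "z = (p, u)" by (cases z)
      have "(\<lambda>n. T (a n) u) \<longlonglongrightarrow> u"
        unfolding tendsto_coordinate T_def affine_map_def ev_def
        using tendsto_mult_right[OF a(4)] by fastforce
      then have "(\<lambda>n. (p, T (a n) u)) \<longlonglongrightarrow> (p, u)" by (intro tendsto_Pair tendsto_const)
      moreover have "\<forall>\<^sub>F n in sequentially. (p, T (a n) u) = \<psi> (a n) (p, u)"
        using central_eventually_fixes[OF a(1,2), of p] elim
        by (auto elim!: eventually_mono simp: z \<psi>_def)
      ultimately show ?case unfolding z using tendsto_cong by fastforce
    qed
  qed (fact countable \<iota> a prob_M sets_M mp)+
qed

end

section \<open>Groups with a central sequence diverging to infinity\<close>

theorem theorem1p5: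
  fixes G :: "('g, 'r) monoid_scheme"
  assumes "group G" and "countable (carrier G)"
    and "\<exists>g. central_sequence G g \<and> diverges_to_infinity G g"
  shows "schmidt_property G"
proof -
  interpret group G by fact
  obtain g where g: "central_sequence G g" "diverges_to_infinity G g" using assms(3) by blast
  obtain A \<theta> a where A: "subgroup A G"
    and \<theta>: "\<And>j::nat. character (G\<lparr>carrier := A\<rparr>) (\<theta> j)" "\<And>x. x \<in> A \<Longrightarrow> x \<noteq> \<one>\<^bsub>G\<^esub> \<Longrightarrow> \<exists>j. \<theta> j x \<noteq> 1"
    and a: "central_sequence G a" "\<And>n. a n \<in> A" "\<And>n. a n \<noteq> \<one>\<^bsub>G\<^esub>" "\<And>j. (\<lambda>n. \<theta> j (a n)) \<longlonglongrightarrow> 1"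
    by (rule central_sequence_with_characters[OF assms(2) g]) blast
  obtain P s where "coset_cocycle G A P s" and P: "P = UNIV \<or> (\<exists>d>0. P = {..<d})"
    by (rule coset_enumeration[OF assms(2) A])
  then interpret coset_cocycle G A P s by simp
  show ?thesis
  proof (cases "P = UNIV")
    case True
    then show ?thesis by (rule schmidt_property_infinite_index[OF assms(2) _ \<theta> a])
  next
    case False
    then have "finite P" "P \<noteq> {}" using P by auto
    then show ?thesis by (rule schmidt_property_finite_index[OF assms(2) _ _ \<theta> a])
  qed
qed

end
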